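(* Let $P(s)$ be a quantifier-free predicate on finite sequences $s:X^*$, and write $\bar P(u,n):\equiv P([u](n))$ for $u:X^{\mathbb N}$, $n:\mathbb N$. For $v,w:X^{\mathbb N}$, $\gamma:\mathbb N\to X^{\mathbb N}\to\mathbb N$ and $m:\mathbb N$ put $$C(v,\gamma,m,w):\equiv \bigl(w_0\lhd v_m\to\neg\bar P([v](m)\ast w,\gamma m w)\bigr).$$ Let $\bar u:X^{\mathbb N}$, let $N,M:X^{\mathbb N}\to(\mathbb N\to X^{\mathbb N}\to\mathbb N)\to\mathbb N$ and let $W:X^{\mathbb N}\to(\mathbb N\to X^{\mathbb N}\to\mathbb N)\to X^{\mathbb N}$. Define: (1) $\tilde N\alpha:=N\alpha_0\alpha_1$ for $\alpha:(X\times(X^{\mathbb N}\to\mathbb N))^{\mathbb N}$, where $\alpha_0,\alpha_1$ are the sequences of first and second components of $\alpha$, and $\Psi^N(u):=\mathrm{EOR}^{\tilde N,\tilde N}_{(X,\rhd),\mathbb N}(u)$; (2) $\gamma_u:=\lambda n,v.\,\bigl(\Psi^N([u](n)\ast v)\text{ if }v_0\lhd u_n\bigr)$ for each $u:X^{\mathbb N}$; (3) $\phi(u):=Nu\gamma_u$, $\ \xi_0(u):=Mu\gamma_u$, $\ \xi_1(u):=Wu\gamma_u$, $\ \xi(u):=[u](\xi_0(u))\ast\xi_1(u)$, and $C_0(u):\equiv C(u,\gamma_u,Mu\gamma_u,Wu\gamma_u)$; (4) the sequence $(u_i)_{i\in\mathbb N}$ of elements of $X^{\mathbb N}$ by $u_0:=\bar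 u$, and $u_{i+1}:=\mathrm{spec}(u_i,\phi)$ if $C_0(\mathrm{spec}(u_i,\phi))$, $u_{i+1}:=\xi(\mathrm{spec}(u_i,\phi))$ otherwise; (5) $n:=\Psi^N(\bar u)$, $\ v:=\mathrm{spec}(u_k,\phi)$ for the least $k$ with $C_0(\mathrm{spec}(u_k,\phi))$ (such a $k$ exists), and $\gamma:=\gamma_v$. Then, provably in $\mathrm{CONT}$, $$\bar P(\bar u,n)\to\bar P(v,Nv\gamma)\wedge C(v,\gamma,Mv\gamma,Wv\gamma),$$ and therefore $n,v,\gamma$ solve the functional interpretation of the principle $\mathrm{ZL}$, i.e. they witness the existential quantifiers in $$(\forall \bar u,N,M,W)(\exists n,v,\gamma)\bigl(\bar P(\bar u,n)\to\bar P(v,Nv\gamma)\wedge C(v,\gamma,Mv\gamma,Wv\gamma)\bigr).$$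
   Context: Finite types are built from $\mathbb B,\mathbb N$ by products, finite sequences $X^*$ and function types $X\to Y$; $X^{\mathbb N}:=\mathbb N\to X$. Each type $X$ has a canonical zero object $0_X$ ($0_{\mathbb N}=0$, $0_{\mathbb B}=0$, $0_{X\times Y}=\langle 0_X,0_Y\rangle$, $0_{X^*}=\langle\rangle$, $0_{X\to Y}=\lambda x.0_Y$). $[u](n):=\langle u_0,\ldots,u_{n-1}\rangle$ is the initial segment of length $n$, and $s\ast v$ is concatenation of a finite with an infinite sequence. $(E\text{ if }A)$ means $E$ if $A$ holds and the zero object of the appropriate type otherwise. $X$ is a type with a primitive recursive (decidable) wellfounded relation $\lhd$ (with inverse $\rhd$), and $0_X$ is assumed minimal: no $x$ satisfies $x\lhd 0_X$. For $\alpha:Z^{\mathbb N}$, $m:\mathbb N$: $\mathrm{ext}(\alpha,m):Z^{\mathbb N}$ is the sequence with $n$-th entry $\alpha_n$ if $n<m$ and $0_Z$ otherwise. For $F:Z^{\mathbb N}\to\mathbb N$: $\mathrm{spec}(\alpha,F):Z^{\mathbb N}$ has $n$-th entry $0_Z$ if $(\exists m\le n)(F(\mathrm{ext}(\alpha,m))<m)$, and $\alpha_n$ otherwise. The explicitly controlled open recursor $\mathrm{EOR}_{(X,\rhd),Y}$ takes $H:(X\times(X^{\mathbb N}\to Y))^{\mathbb N}\to Y$, $F:(X\times(X^{\mathbb N}\to Y))^{\mathbb N}\to\mathbb N$ and $u:X^{\mathbb N}$, with defining equation $$\mathrm{EOR}^{H,F}(u)=_Y H(\mathrm{spec}(\alpha,F)),\qquad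 \alpha:=\lambda n.\,\bigl\langle u_n,\ \lambda v.\,(\mathrm{EOR}^{H,F}([u](n)\ast v)\text{ if }v_0\lhd u_n)\bigr\rangle .$$ $\mathrm{CONT}$ is the axiom that every $F:Z^{\mathbb N}\to\mathbb N$ satisfies $(\forall\alpha)(\exists N)(\forall\beta)([\alpha](N)=[\beta](N)\to F(\alpha)=F(\beta))$. "Provably in CONT" means: in fully extensional classical arithmetic in all finite types, together with the recursor $\mathrm{EOR}$ and its defining equation, and assuming $\mathrm{CONT}$. $\mathrm{ZL}$ is the principle $(\exists u)(\forall n)\bar P(u,n)\to(\exists v)\bigl((\forall n)\bar P(v,n)\wedge(\forall m,w)(w_0\lhd v_m\to(\exists n)\neg\bar P([v](m)\ast w,n))\bigr)$; the displayed $\forall\exists$ formula is the (Gödel) functional interpretation of its negative translation. *)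

theory Defs
  imports Main
begin

text \<open>
  Provability in a formal theory is at stake, so the theory is represented by a deep embedding:
  simply typed terms and formulas in locally nameless style (bound variables are de Bruijn
  indices, free variables carry a name and a type), and a natural deduction calculus for classical
  many-sorted predicate logic with equality. A deep embedding is essential here: for the full
  function spaces of HOL the continuity axiom is false.
\<close>

section \<open>Types, terms, formulas\<close>

datatype ty = TB | TN | TProd ty ty | TSeq ty | TFun ty ty  (infixr "\<rightarrow>" 75)

abbreviation Sq :: "ty \<Rightarrow> ty" where "Sq Z \<equiv> TN \<rightarrow> Z"

datatype cst =
    CTrue | CFalse | CCond ty
  | CZero | CSuc | CRec ty
  | CPair ty ty | CFst ty ty | CSnd ty ty
  | CNil ty | CSnoc ty | CSRec ty ty
  | CEOR ty ty

datatype tm =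
    Bnd nat
  | Fre string ty
  | Cst cst
  | App tm tm  (infixl "\<cdot>" 200)
  | Lam ty tm

datatype fm =
    Eq ty tm tm
  | Fls  ("\<^bold>\<bottom>")
  | Imp fm fm  (infixr "\<^bold>\<longrightarrow>" 25)
  | All ty fm

text \<open>Finite sequences are generated by appending on the right. The constant \<open>CEOR X Y\<close> is the
  recursor for the pair of \<open>X\<close> and the one relation on \<open>X\<close> over which the theory is formed; the
  relation enters only through the defining equation of the recursor.\<close>

primrec cst_ty :: "cst \<Rightarrow> ty" where
  "cst_ty CTrue = TB"
| "cst_ty CFalse = TB"
| "cst_ty (CCond Z) = TB \<rightarrow> Z \<rightarrow> Z \<rightarrow> Z"
| "cst_ty CZero = TN"
| "cst_ty CSuc = TN \<rightarrow> TN"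
| "cst_ty (CRec Z) = Z \<rightarrow> (TN \<rightarrow> Z \<rightarrow> Z) \<rightarrow> TN \<rightarrow> Z"
| "cst_ty (CPair Y Z) = Y \<rightarrow> Z \<rightarrow> TProd Y Z"
| "cst_ty (CFst Y Z) = TProd Y Z \<rightarrow> Y"
| "cst_ty (CSnd Y Z) = TProd Y Z \<rightarrow> Z"
| "cst_ty (CNil Z) = TSeq Z"
| "cst_ty (CSnoc Z) = TSeq Z \<rightarrow> Z \<rightarrow> TSeq Z"
| "cst_ty (CSRec Y Z) = Z \<rightarrow> (TSeq Y \<rightarrow> Y \<rightarrow> Z \<rightarrow> Z) \<rightarrow> TSeq Y \<rightarrow> Z"
| "cst_ty (CEOR X Y) =
     (Sq (TProd X (Sq X \<rightarrow> Y)) \<rightarrow> Y) \<rightarrow> (Sq (TProd X (Sq X \<rightarrow> Y)) \<rightarrow> TN) \<rightarrow> Sq X \<rightarrow> Y"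

text \<open>The context lists the types of the dangling indices; \<open>wt [] t Z\<close> means that \<open>t\<close> is a term of
  type \<open>Z\<close>, and \<open>wff [Z] A\<close> that \<open>A\<close> is a formula with one slot (index 0) of type \<open>Z\<close>.\<close>

primrec wt :: "ty list \<Rightarrow> tm \<Rightarrow> ty \<Rightarrow> bool" where
  "wt \<Gamma> (Bnd i) Z = (i < length \<Gamma> \<and> \<Gamma> ! i = Z)"
| "wt \<Gamma> (Fre x Y) Z = (Y = Z)"
| "wt \<Gamma> (Cst c) Z = (cst_ty c = Z)"
| "wt \<Gamma> (s \<cdot> t) Z = (\<exists>Y. wt \<Gamma> s (Y \<rightarrow> Z) \<and> wt \<Gamma> t Y)"
| "wt \<Gamma> (Lam Y t) Z = (\<exists>V. Z = (Y \<rightarrow> V) \<and> wt (Y # \<Gamma>) t V)"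

primrec wff :: "ty list \<Rightarrow> fm \<Rightarrow> bool" where
  "wff \<Gamma> (Eq Z s t) = (wt \<Gamma> s Z \<and> wt \<Gamma> t Z)"
| "wff \<Gamma> \<^bold>\<bottom> = True"
| "wff \<Gamma> (A \<^bold>\<longrightarrow> B) = (wff \<Gamma> A \<and> wff \<Gamma> B)"
| "wff \<Gamma> (All Z A) = wff (Z # \<Gamma>) A"

primrec fv_tm :: "tm \<Rightarrow> (string \<times> ty) set" where
  "fv_tm (Bnd i) = {}"
| "fv_tm (Fre x Z) = {(x, Z)}"
| "fv_tm (Cst c) = {}"
| "fv_tm (s \<cdot> t) = fv_tm s \<union> fv_tm t"
| "fv_tm (Lam Z t) = fv_tm t"

primrec fv_fm :: "fm \<Rightarrow> (string \<times> ty) set" where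
  "fv_fm (Eq Z s t) = fv_tm s \<union> fv_tm t"
| "fv_fm \<^bold>\<bottom> = {}"
| "fv_fm (A \<^bold>\<longrightarrow> B) = fv_fm A \<union> fv_fm B"
| "fv_fm (All Z A) = fv_fm A"

text \<open>Filling the slot \<open>k\<close>; only used with terms \<open>u\<close> without dangling indices.\<close>

primrec inst_tm :: "nat \<Rightarrow> tm \<Rightarrow> tm \<Rightarrow> tm" where
  "inst_tm k u (Bnd i) = (if i = k then u else Bnd i)"
| "inst_tm k u (Fre x Z) = Fre x Z"
| "inst_tm k u (Cst c) = Cst c"
| "inst_tm k u (s \<cdot> t) = inst_tm k u s \<cdot> inst_tm k u t"
| "inst_tm k u (Lam Z t) = Lam Z (inst_tm (Suc k) u t)"

primrec inst_fm :: "nat \<Rightarrow> tm \<Rightarrow> fm \<Rightarrow> fm" where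
  "inst_fm k u (Eq Z s t) = Eq Z (inst_tm k u s) (inst_tm k u t)"
| "inst_fm k u \<^bold>\<bottom> = \<^bold>\<bottom>"
| "inst_fm k u (A \<^bold>\<longrightarrow> B) = (inst_fm k u A \<^bold>\<longrightarrow> inst_fm k u B)"
| "inst_fm k u (All Z A) = All Z (inst_fm (Suc k) u A)"

abbreviation fill :: "fm \<Rightarrow> tm \<Rightarrow> fm"  ("_\<lbrakk>_\<rbrakk>" [1000, 0] 999) where
  "A\<lbrakk>t\<rbrakk> \<equiv> inst_fm 0 t A"

text \<open>The converse operation: turning a free variable into a slot.\<close>

primrec abs_tm :: "nat \<Rightarrow> string \<Rightarrow> ty \<Rightarrow> tm \<Rightarrow> tm" where
  "abs_tm k x Y (Bnd i) = Bnd i"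
| "abs_tm k x Y (Fre y Z) = (if y = x \<and> Z = Y then Bnd k else Fre y Z)"
| "abs_tm k x Y (Cst c) = Cst c"
| "abs_tm k x Y (s \<cdot> t) = abs_tm k x Y s \<cdot> abs_tm k x Y t"
| "abs_tm k x Y (Lam Z t) = Lam Z (abs_tm (Suc k) x Y t)"

primrec abs_fm :: "nat \<Rightarrow> string \<Rightarrow> ty \<Rightarrow> fm \<Rightarrow> fm" where
  "abs_fm k x Y (Eq Z s t) = Eq Z (abs_tm k x Y s) (abs_tm k x Y t)"
| "abs_fm k x Y \<^bold>\<bottom> = \<^bold>\<bottom>"
| "abs_fm k x Y (A \<^bold>\<longrightarrow> B) = (abs_fm k x Y A \<^bold>\<longrightarrow> abs_fm k x Y B)"
| "abs_fm k x Y (All Z A) = All Z (abs_fm (Suc k) x Y A)"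

text \<open>Binders with explicit names. \<open>lam ''x'' Z (\<lambda>x. t)\<close> is the term $\lambda x^Z.t$: the HOL-bound
  \<open>x\<close> stands for the free variable \<open>Fre ''x'' Z\<close>, which is then bound. As with any named binder,
  \<open>t\<close> must not contain an unrelated free variable with the same name and type. Below, operations
  are introduced as closed terms and used by application, so that no capture can occur.\<close>

definition lam :: "string \<Rightarrow> ty \<Rightarrow> (tm \<Rightarrow> tm) \<Rightarrow> tm" where
  "lam x Z f = Lam Z (abs_tm 0 x Z (f (Fre x Z)))"

definition all :: "string \<Rightarrow> ty \<Rightarrow> (tm \<Rightarrow> fm) \<Rightarrow> fm" where
  "all x Z F = All Z (abs_fm 0 x Z (F (Fre x Z)))"

definition Neg :: "fm \<Rightarrow> fm"  ("\<^bold>\<not> _" [40] 40) where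
  "(\<^bold>\<not> A) = (A \<^bold>\<longrightarrow> \<^bold>\<bottom>)"

definition Conj :: "fm \<Rightarrow> fm \<Rightarrow> fm"  (infixr "\<^bold>\<and>" 35) where
  "(A \<^bold>\<and> B) = (\<^bold>\<not> (A \<^bold>\<longrightarrow> \<^bold>\<not> B))"

definition Disj :: "fm \<Rightarrow> fm \<Rightarrow> fm"  (infixr "\<^bold>\<or>" 30) where
  "(A \<^bold>\<or> B) = ((\<^bold>\<not> A) \<^bold>\<longrightarrow> B)"

definition ex :: "string \<Rightarrow> ty \<Rightarrow> (tm \<Rightarrow> fm) \<Rightarrow> fm" where
  "ex x Z F = (\<^bold>\<not> (all x Z (\<lambda>t. \<^bold>\<not> (F t))))"

text \<open>Prime formulas of the theory are equations between terms of base type. Equality at higher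
  types is a primitive of the calculus governed by extensionality, but it does not count as
  quantifier-free.\<close>

primrec qf :: "fm \<Rightarrow> bool" where
  "qf (Eq Z s t) = (Z = TB \<or> Z = TN)"
| "qf \<^bold>\<bottom> = True"
| "qf (A \<^bold>\<longrightarrow> B) = (qf A \<and> qf B)"
| "qf (All Z A) = False"


section \<open>Terms of the language\<close>

abbreviation "tt \<equiv> Cst CTrue"
abbreviation "ff \<equiv> Cst CFalse"
abbreviation "Cond Z \<equiv> Cst (CCond Z)"
abbreviation "Ze \<equiv> Cst CZero"
abbreviation "Su \<equiv> Cst CSuc"
abbreviation "Rec Z \<equiv> Cst (CRec Z)"
abbreviation "Pr Y Z \<equiv> Cst (CPair Y Z)"
abbreviation "Pfst Y Z \<equiv> Cst (CFst Y Z)"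
abbreviation "Psnd Y Z \<equiv> Cst (CSnd Y Z)"
abbreviation "Nl Z \<equiv> Cst (CNil Z)"
abbreviation "Snoc Z \<equiv> Cst (CSnoc Z)"
abbreviation "SRec Y Z \<equiv> Cst (CSRec Y Z)"
abbreviation "EOR X Y \<equiv> Cst (CEOR X Y)"

text \<open>A Boolean term read as a formula.\<close>

definition Tr :: "tm \<Rightarrow> fm" where "Tr b = Eq TB b tt"

primrec zero :: "ty \<Rightarrow> tm" where
  "zero TB = ff"
| "zero TN = Ze"
| "zero (TProd Y Z) = Pr Y Z \<cdot> zero Y \<cdot> zero Z"
| "zero (TSeq Z) = Nl Z"
| "zero (Y \<rightarrow> Z) = Lam Y (zero Z)"

text \<open>\<open>ifz Z b e\<close> is ($e$ if $b$).\<close>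

definition ifz :: "ty \<Rightarrow> tm \<Rightarrow> tm \<Rightarrow> tm" where
  "ifz Z b e = Cond Z \<cdot> b \<cdot> e \<cdot> zero Z"

definition predt :: tm where
  "predt = Rec TN \<cdot> Ze \<cdot> lam ''i'' TN (\<lambda>i. lam ''r'' TN (\<lambda>r. i))"

definition subt :: tm where
  "subt = lam ''m'' TN (\<lambda>m. lam ''n'' TN (\<lambda>n.
     Rec TN \<cdot> m \<cdot> lam ''i'' TN (\<lambda>i. lam ''r'' TN (\<lambda>r. predt \<cdot> r)) \<cdot> n))"

definition post :: tm where
  "post = Rec TB \<cdot> ff \<cdot> lam ''i'' TN (\<lambda>i. lam ''r'' TB (\<lambda>r. tt))"

definition lesst :: tm where
  "lesst = lam ''m'' TN (\<lambda>m. lam ''n'' TN (\<lambda>n. post \<cdot> (subt \<cdot> n \<cdot> m)))"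

text \<open>\<open>bext \<cdot> f \<cdot> n\<close> decides $(\exists m\le n)\, f m$.\<close>

definition bext :: tm where
  "bext = lam ''f'' (TN \<rightarrow> TB) (\<lambda>f. lam ''n'' TN (\<lambda>n.
     Rec TB \<cdot> (f \<cdot> Ze) \<cdot>
       lam ''i'' TN (\<lambda>i. lam ''r'' TB (\<lambda>r. Cond TB \<cdot> r \<cdot> tt \<cdot> (f \<cdot> (Su \<cdot> i)))) \<cdot> n))"

definition eqNt :: tm where
  "eqNt = lam ''m'' TN (\<lambda>m. lam ''n'' TN (\<lambda>n.
     Cond TB \<cdot> (lesst \<cdot> m \<cdot> n) \<cdot> ff \<cdot> (Cond TB \<cdot> (lesst \<cdot> n \<cdot> m) \<cdot> ff \<cdot> tt)))"

definition eqBt :: tm where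
  "eqBt = lam ''a'' TB (\<lambda>a. lam ''b'' TB (\<lambda>b. Cond TB \<cdot> a \<cdot> b \<cdot> (Cond TB \<cdot> b \<cdot> ff \<cdot> tt)))"

text \<open>The characteristic term of a quantifier-free formula (meaningless on other formulas).\<close>

primrec chi :: "fm \<Rightarrow> tm" where
  "chi (Eq Z s t) = (if Z = TN then eqNt \<cdot> s \<cdot> t else eqBt \<cdot> s \<cdot> t)"
| "chi \<^bold>\<bottom> = ff"
| "chi (A \<^bold>\<longrightarrow> B) = Cond TB \<cdot> chi A \<cdot> chi B \<cdot> tt"
| "chi (All Z A) = ff"

text \<open>\<open>init Z \<cdot> u \<cdot> n\<close> is $[u](n)$, \<open>push\<close> adds an entry in front of an infinite sequence, and
  \<open>cat Z \<cdot> s \<cdot> v\<close> is $s\ast v$.\<close>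

definition init :: "ty \<Rightarrow> tm" where
  "init Z = lam ''u'' (Sq Z) (\<lambda>u.
     Rec (TSeq Z) \<cdot> Nl Z \<cdot> lam ''i'' TN (\<lambda>i. lam ''s'' (TSeq Z) (\<lambda>s. Snoc Z \<cdot> s \<cdot> (u \<cdot> i))))"

definition push :: "ty \<Rightarrow> tm" where
  "push Z = lam ''x'' Z (\<lambda>x. lam ''v'' (Sq Z) (\<lambda>v.
     Rec Z \<cdot> x \<cdot> lam ''i'' TN (\<lambda>i. lam ''r'' Z (\<lambda>r. v \<cdot> i))))"

definition cat :: "ty \<Rightarrow> tm" where
  "cat Z = SRec Z (Sq Z \<rightarrow> Sq Z) \<cdot> lam ''v'' (Sq Z) (\<lambda>v. v) \<cdot>
     lam ''s'' (TSeq Z) (\<lambda>s. lam ''x'' Z (\<lambda>x. lam ''r'' (Sq Z \<rightarrow> Sq Z) (\<lambda>r.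
       lam ''v'' (Sq Z) (\<lambda>v. r \<cdot> (push Z \<cdot> x \<cdot> v)))))"

definition ext :: "ty \<Rightarrow> tm" where
  "ext Z = lam ''a'' (Sq Z) (\<lambda>a. lam ''m'' TN (\<lambda>m. lam ''n'' TN (\<lambda>n.
     ifz Z (lesst \<cdot> n \<cdot> m) (a \<cdot> n))))"

definition spec :: "ty \<Rightarrow> tm" where
  "spec Z = lam ''a'' (Sq Z) (\<lambda>a. lam ''F'' (Sq Z \<rightarrow> TN) (\<lambda>F. lam ''n'' TN (\<lambda>n.
     Cond Z \<cdot> (bext \<cdot> lam ''m'' TN (\<lambda>m. lesst \<cdot> (F \<cdot> (ext Z \<cdot> a \<cdot> m)) \<cdot> m) \<cdot> n)
       \<cdot> zero Z \<cdot> (a \<cdot> n))))"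

text \<open>The sequence $\alpha$ in the defining equation of the recursor, as a function of $H,F,u$;
  \<open>lt \<cdot> x \<cdot> y\<close> decides $x\lhd y$.\<close>

definition eor_arg :: "ty \<Rightarrow> tm \<Rightarrow> ty \<Rightarrow> tm" where
  "eor_arg X lt Y =
    (let Z = TProd X (Sq X \<rightarrow> Y) in
     lam ''H'' (Sq Z \<rightarrow> Y) (\<lambda>H. lam ''F'' (Sq Z \<rightarrow> TN) (\<lambda>F. lam ''u'' (Sq X) (\<lambda>u.
       lam ''n'' TN (\<lambda>n. Pr X (Sq X \<rightarrow> Y) \<cdot> (u \<cdot> n) \<cdot>
         lam ''v'' (Sq X) (\<lambda>v. ifz Y (lt \<cdot> (v \<cdot> Ze) \<cdot> (u \<cdot> n))
           (EOR X Y \<cdot> H \<cdot> F \<cdot> (cat X \<cdot> (init X \<cdot> u \<cdot> n) \<cdot> v))))))))"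


section \<open>The theory: extensional classical arithmetic with the recursor and continuity\<close>

text \<open>Axioms may contain free variables, which are understood universally.\<close>

inductive_set axs :: "ty \<Rightarrow> tm \<Rightarrow> fm set" for X :: ty and lt :: tm where
  ax_beta: "\<lbrakk>wt [Y] b Z; wt [] t Y\<rbrakk> \<Longrightarrow> Eq Z (Lam Y b \<cdot> t) (inst_tm 0 t b) \<in> axs X lt"
| ax_extensionality: "\<lbrakk>wt [] f (Y \<rightarrow> Z); wt [] g (Y \<rightarrow> Z); (x, Y) \<notin> fv_tm f \<union> fv_tm g\<rbrakk> \<Longrightarrow>
    (all x Y (\<lambda>x. Eq Z (f \<cdot> x) (g \<cdot> x)) \<^bold>\<longrightarrow> Eq (Y \<rightarrow> Z) f g) \<in> axs X lt"
| ax_tt_ff: "(\<^bold>\<not> Eq TB tt ff) \<in> axs X lt"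
| ax_bool_cases: "wt [] b TB \<Longrightarrow> (Eq TB b tt \<^bold>\<or> Eq TB b ff) \<in> axs X lt"
| ax_cond_tt: "\<lbrakk>wt [] a Z; wt [] b Z\<rbrakk> \<Longrightarrow> Eq Z (Cond Z \<cdot> tt \<cdot> a \<cdot> b) a \<in> axs X lt"
| ax_cond_ff: "\<lbrakk>wt [] a Z; wt [] b Z\<rbrakk> \<Longrightarrow> Eq Z (Cond Z \<cdot> ff \<cdot> a \<cdot> b) b \<in> axs X lt"
| ax_fst_pair: "\<lbrakk>wt [] a Y; wt [] b Z\<rbrakk> \<Longrightarrow> Eq Y (Pfst Y Z \<cdot> (Pr Y Z \<cdot> a \<cdot> b)) a \<in> axs X lt"
| ax_snd_pair: "\<lbrakk>wt [] a Y; wt [] b Z\<rbrakk> \<Longrightarrow> Eq Z (Psnd Y Z \<cdot> (Pr Y Z \<cdot> a \<cdot> b)) b \<in> axs X lt"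
| ax_pair_surj: "wt [] p (TProd Y Z) \<Longrightarrow>
    Eq (TProd Y Z) (Pr Y Z \<cdot> (Pfst Y Z \<cdot> p) \<cdot> (Psnd Y Z \<cdot> p)) p \<in> axs X lt"
| ax_suc_zero: "wt [] n TN \<Longrightarrow> (\<^bold>\<not> Eq TN (Su \<cdot> n) Ze) \<in> axs X lt"
| ax_suc_inj: "\<lbrakk>wt [] m TN; wt [] n TN\<rbrakk> \<Longrightarrow>
    (Eq TN (Su \<cdot> m) (Su \<cdot> n) \<^bold>\<longrightarrow> Eq TN m n) \<in> axs X lt"
| ax_rec_zero: "\<lbrakk>wt [] a Z; wt [] f (TN \<rightarrow> Z \<rightarrow> Z)\<rbrakk> \<Longrightarrow> Eq Z (Rec Z \<cdot> a \<cdot> f \<cdot> Ze) a \<in> axs X lt"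
| ax_rec_suc: "\<lbrakk>wt [] a Z; wt [] f (TN \<rightarrow> Z \<rightarrow> Z); wt [] n TN\<rbrakk> \<Longrightarrow>
    Eq Z (Rec Z \<cdot> a \<cdot> f \<cdot> (Su \<cdot> n)) (f \<cdot> n \<cdot> (Rec Z \<cdot> a \<cdot> f \<cdot> n)) \<in> axs X lt"
| ax_nat_induction: "\<lbrakk>wff [TN] A; (n, TN) \<notin> fv_fm A\<rbrakk> \<Longrightarrow>
    (A\<lbrakk>Ze\<rbrakk> \<^bold>\<longrightarrow> all n TN (\<lambda>n. A\<lbrakk>n\<rbrakk> \<^bold>\<longrightarrow> A\<lbrakk>Su \<cdot> n\<rbrakk>) \<^bold>\<longrightarrow> All TN A) \<in> axs X lt"
| ax_snoc_nil: "\<lbrakk>wt [] s (TSeq Z); wt [] a Z\<rbrakk> \<Longrightarrow>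
    (\<^bold>\<not> Eq (TSeq Z) (Snoc Z \<cdot> s \<cdot> a) (Nl Z)) \<in> axs X lt"
| ax_snoc_inj: "\<lbrakk>wt [] s (TSeq Z); wt [] a Z; wt [] t (TSeq Z); wt [] b Z\<rbrakk> \<Longrightarrow>
    (Eq (TSeq Z) (Snoc Z \<cdot> s \<cdot> a) (Snoc Z \<cdot> t \<cdot> b) \<^bold>\<longrightarrow> Eq (TSeq Z) s t \<^bold>\<and> Eq Z a b) \<in> axs X lt"
| ax_srec_nil: "\<lbrakk>wt [] a Z; wt [] f (TSeq Y \<rightarrow> Y \<rightarrow> Z \<rightarrow> Z)\<rbrakk> \<Longrightarrow>
    Eq Z (SRec Y Z \<cdot> a \<cdot> f \<cdot> Nl Y) a \<in> axs X lt"
| ax_srec_snoc: "\<lbrakk>wt [] a Z; wt [] f (TSeq Y \<rightarrow> Y \<rightarrow> Z \<rightarrow> Z); wt [] s (TSeq Y); wt [] b Y\<rbrakk> \<Longrightarrow>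
    Eq Z (SRec Y Z \<cdot> a \<cdot> f \<cdot> (Snoc Y \<cdot> s \<cdot> b)) (f \<cdot> s \<cdot> b \<cdot> (SRec Y Z \<cdot> a \<cdot> f \<cdot> s)) \<in> axs X lt"
| ax_seq_induction: "\<lbrakk>wff [TSeq Z] A; (s, TSeq Z) \<notin> fv_fm A; (a, Z) \<notin> fv_fm A\<rbrakk> \<Longrightarrow>
    (A\<lbrakk>Nl Z\<rbrakk> \<^bold>\<longrightarrow>
      all s (TSeq Z) (\<lambda>s. all a Z (\<lambda>a. A\<lbrakk>s\<rbrakk> \<^bold>\<longrightarrow> A\<lbrakk>Snoc Z \<cdot> s \<cdot> a\<rbrakk>)) \<^bold>\<longrightarrow>
      All (TSeq Z) A) \<in> axs X lt"
| ax_EOR_eq: "\<lbrakk>Z = TProd X (Sq X \<rightarrow> Y); wt [] H (Sq Z \<rightarrow> Y); wt [] F (Sq Z \<rightarrow> TN); wt [] u (Sq X)\<rbrakk> \<Longrightarrow>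
    Eq Y (EOR X Y \<cdot> H \<cdot> F \<cdot> u) (H \<cdot> (spec Z \<cdot> (eor_arg X lt Y \<cdot> H \<cdot> F \<cdot> u) \<cdot> F)) \<in> axs X lt"
| ax_CONT:
    "all ''F'' (Sq Z \<rightarrow> TN) (\<lambda>F. all ''a'' (Sq Z) (\<lambda>a. ex ''n'' TN (\<lambda>n. all ''b'' (Sq Z) (\<lambda>b.
       Eq (TSeq Z) (init Z \<cdot> a \<cdot> n) (init Z \<cdot> b \<cdot> n) \<^bold>\<longrightarrow> Eq TN (F \<cdot> a) (F \<cdot> b))))) \<in> axs X lt"

inductive deriv :: "fm set \<Rightarrow> fm set \<Rightarrow> fm \<Rightarrow> bool" for Ax :: "fm set" where
  d_axiom: "A \<in> Ax \<Longrightarrow> deriv Ax \<Delta> A"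
| d_hyp: "\<lbrakk>A \<in> \<Delta>; wff [] A\<rbrakk> \<Longrightarrow> deriv Ax \<Delta> A"
| d_impI: "\<lbrakk>wff [] A; deriv Ax (insert A \<Delta>) B\<rbrakk> \<Longrightarrow> deriv Ax \<Delta> (A \<^bold>\<longrightarrow> B)"
| d_impE: "\<lbrakk>deriv Ax \<Delta> (A \<^bold>\<longrightarrow> B); deriv Ax \<Delta> A\<rbrakk> \<Longrightarrow> deriv Ax \<Delta> B"
| d_classical: "\<lbrakk>wff [] A; deriv Ax (insert (\<^bold>\<not> A) \<Delta>) \<^bold>\<bottom>\<rbrakk> \<Longrightarrow> deriv Ax \<Delta> A"
| d_allI: "\<lbrakk>deriv Ax \<Delta> (A\<lbrakk>Fre x Z\<rbrakk>); (x, Z) \<notin> fv_fm A; \<forall>B\<in>\<Delta>. (x, Z) \<notin> fv_fm B; wff [Z] A\<rbrakk> \<Longrightarrow>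
    deriv Ax \<Delta> (All Z A)"
| d_allE: "\<lbrakk>deriv Ax \<Delta> (All Z A); wt [] t Z\<rbrakk> \<Longrightarrow> deriv Ax \<Delta> (A\<lbrakk>t\<rbrakk>)"
| d_refl: "wt [] t Z \<Longrightarrow> deriv Ax \<Delta> (Eq Z t t)"
| d_subst: "\<lbrakk>deriv Ax \<Delta> (Eq Z s t); wff [Z] A; deriv Ax \<Delta> (A\<lbrakk>s\<rbrakk>)\<rbrakk> \<Longrightarrow> deriv Ax \<Delta> (A\<lbrakk>t\<rbrakk>)"

definition provable :: "ty \<Rightarrow> tm \<Rightarrow> fm \<Rightarrow> bool" where
  "provable X lt A = deriv (axs X lt) {} A"


section \<open>The relation on \<open>X\<close>\<close>

primrec eor_free :: "tm \<Rightarrow> bool" where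
  "eor_free (Bnd i) = True"
| "eor_free (Fre x Z) = True"
| "eor_free (Cst c) = (\<forall>X Y. c \<noteq> CEOR X Y)"
| "eor_free (s \<cdot> t) = (eor_free s \<and> eor_free t)"
| "eor_free (Lam Z t) = eor_free t"

definition prim_rec_relation :: "ty \<Rightarrow> tm \<Rightarrow> bool" where
  "prim_rec_relation X lt \<longleftrightarrow> wt [] lt (X \<rightarrow> X \<rightarrow> TB) \<and> fv_tm lt = {} \<and> eor_free lt"

text \<open>Wellfoundedness in a formal theory: transfinite induction along the relation is provable for
  every formula of the language (with parameters).\<close>

definition wellfounded_relation :: "ty \<Rightarrow> tm \<Rightarrow> bool" where
  "wellfounded_relation X lt \<longleftrightarrow>
    (\<forall>A x y. wff [X] A \<longrightarrow> x \<noteq> y \<longrightarrow> (x, X) \<notin> fv_fm A \<longrightarrow> (y, X) \<notin> fv_fm A \<longrightarrow>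
      provable X lt
        (all x X (\<lambda>x. all y X (\<lambda>y. Tr (lt \<cdot> y \<cdot> x) \<^bold>\<longrightarrow> A\<lbrakk>y\<rbrakk>) \<^bold>\<longrightarrow> A\<lbrakk>x\<rbrakk>) \<^bold>\<longrightarrow> All X A))"

definition zero_minimal :: "ty \<Rightarrow> tm \<Rightarrow> bool" where
  "zero_minimal X lt \<longleftrightarrow> provable X lt (all ''x'' X (\<lambda>x. \<^bold>\<not> Tr (lt \<cdot> x \<cdot> zero X)))"


section \<open>The solution of the functional interpretation of ZL\<close>

abbreviation "TyG X \<equiv> TN \<rightarrow> Sq X \<rightarrow> TN"
abbreviation "TyN X \<equiv> Sq X \<rightarrow> TyG X \<rightarrow> TN"
abbreviation "TyW X \<equiv> Sq X \<rightarrow> TyG X \<rightarrow> Sq X"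

text \<open>The predicate $P(s)$ is a formula \<open>P\<close> with a slot for $s$, so that \<open>P\<lbrakk>t\<rbrakk>\<close> is $P(t)$.\<close>

definition Pbar :: "ty \<Rightarrow> fm \<Rightarrow> tm \<Rightarrow> tm \<Rightarrow> fm" where
  "Pbar X P u n = P\<lbrakk>init X \<cdot> u \<cdot> n\<rbrakk>"

definition Cf :: "ty \<Rightarrow> tm \<Rightarrow> fm \<Rightarrow> tm \<Rightarrow> tm \<Rightarrow> tm \<Rightarrow> tm \<Rightarrow> fm" where
  "Cf X lt P v g m w =
    (Tr (lt \<cdot> (w \<cdot> Ze) \<cdot> (v \<cdot> m)) \<^bold>\<longrightarrow>
      \<^bold>\<not> Pbar X P (cat X \<cdot> (init X \<cdot> v \<cdot> m) \<cdot> w) (g \<cdot> m \<cdot> w))"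

definition tilde :: "ty \<Rightarrow> tm" where
  "tilde X = lam ''N'' (TyN X) (\<lambda>N. lam ''a'' (Sq (TProd X (Sq X \<rightarrow> TN))) (\<lambda>a.
     N \<cdot> lam ''n'' TN (\<lambda>n. Pfst X (Sq X \<rightarrow> TN) \<cdot> (a \<cdot> n))
       \<cdot> lam ''n'' TN (\<lambda>n. Psnd X (Sq X \<rightarrow> TN) \<cdot> (a \<cdot> n))))"

text \<open>\<open>Psi X \<cdot> N \<cdot> u\<close> is $\Psi^N(u)$, \<open>gam X lt \<cdot> N \<cdot> u\<close> is $\gamma_u$, \<open>phi X lt \<cdot> N \<cdot> u\<close> is $\phi(u)$
  and \<open>xi X lt \<cdot> N \<cdot> M \<cdot> W \<cdot> u\<close> is $\xi(u)$.\<close>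

definition Psi :: "ty \<Rightarrow> tm" where
  "Psi X = lam ''N'' (TyN X) (\<lambda>N. lam ''u'' (Sq X) (\<lambda>u.
     EOR X TN \<cdot> (tilde X \<cdot> N) \<cdot> (tilde X \<cdot> N) \<cdot> u))"

definition gam :: "ty \<Rightarrow> tm \<Rightarrow> tm" where
  "gam X lt = lam ''N'' (TyN X) (\<lambda>N. lam ''u'' (Sq X) (\<lambda>u.
     lam ''n'' TN (\<lambda>n. lam ''v'' (Sq X) (\<lambda>v.
       ifz TN (lt \<cdot> (v \<cdot> Ze) \<cdot> (u \<cdot> n)) (Psi X \<cdot> N \<cdot> (cat X \<cdot> (init X \<cdot> u \<cdot> n) \<cdot> v))))))"

definition phi :: "ty \<Rightarrow> tm \<Rightarrow> tm" where
  "phi X lt = lam ''N'' (TyN X) (\<lambda>N. lam ''u'' (Sq X) (\<lambda>u. N \<cdot> u \<cdot> (gam X lt \<cdot> N \<cdot> u)))"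

definition xi :: "ty \<Rightarrow> tm \<Rightarrow> tm" where
  "xi X lt = lam ''N'' (TyN X) (\<lambda>N. lam ''M'' (TyN X) (\<lambda>M. lam ''W'' (TyW X) (\<lambda>W.
     lam ''u'' (Sq X) (\<lambda>u.
       cat X \<cdot> (init X \<cdot> u \<cdot> (M \<cdot> u \<cdot> (gam X lt \<cdot> N \<cdot> u))) \<cdot> (W \<cdot> u \<cdot> (gam X lt \<cdot> N \<cdot> u))))))"

definition C0 :: "ty \<Rightarrow> tm \<Rightarrow> fm \<Rightarrow> tm \<Rightarrow> tm \<Rightarrow> tm \<Rightarrow> tm \<Rightarrow> fm" where
  "C0 X lt P N M W u =
    (let g = gam X lt \<cdot> N \<cdot> u in Cf X lt P u g (M \<cdot> u \<cdot> g) (W \<cdot> u \<cdot> g))"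

text \<open>\<open>useq X lt P \<cdot> ub \<cdot> N \<cdot> M \<cdot> W \<cdot> i\<close> is $u_i$.\<close>

definition useq :: "ty \<Rightarrow> tm \<Rightarrow> fm \<Rightarrow> tm" where
  "useq X lt P = lam ''ub'' (Sq X) (\<lambda>ub. lam ''N'' (TyN X) (\<lambda>N. lam ''M'' (TyN X) (\<lambda>M.
     lam ''W'' (TyW X) (\<lambda>W.
       Rec (Sq X) \<cdot> ub \<cdot> lam ''i'' TN (\<lambda>i. lam ''r'' (Sq X) (\<lambda>r.
         let v = spec X \<cdot> r \<cdot> (phi X lt \<cdot> N) in
         Cond (Sq X) \<cdot> chi (C0 X lt P N M W v) \<cdot> v \<cdot> (xi X lt \<cdot> N \<cdot> M \<cdot> W \<cdot> v)))))))"

text \<open>\<open>is_least_k \<dots> k\<close>: the number $k$ is least with $C_0(\mathrm{spec}(u_k,\phi))$.\<close>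

definition vk :: "ty \<Rightarrow> tm \<Rightarrow> fm \<Rightarrow> tm \<Rightarrow> tm \<Rightarrow> tm \<Rightarrow> tm \<Rightarrow> tm \<Rightarrow> tm" where
  "vk X lt P ub N M W k = spec X \<cdot> (useq X lt P \<cdot> ub \<cdot> N \<cdot> M \<cdot> W \<cdot> k) \<cdot> (phi X lt \<cdot> N)"

definition is_least_k :: "ty \<Rightarrow> tm \<Rightarrow> fm \<Rightarrow> tm \<Rightarrow> tm \<Rightarrow> tm \<Rightarrow> tm \<Rightarrow> tm \<Rightarrow> fm" where
  "is_least_k X lt P ub N M W k =
    (C0 X lt P N M W (vk X lt P ub N M W k) \<^bold>\<and>
     all ''j'' TN (\<lambda>j. Tr (lesst \<cdot> j \<cdot> k) \<^bold>\<longrightarrow> \<^bold>\<not> C0 X lt P N M W (vk X lt P ub N M W j)))"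

text \<open>The matrix of the functional interpretation of ZL.\<close>

definition ZL_matrix ::
    "ty \<Rightarrow> tm \<Rightarrow> fm \<Rightarrow> tm \<Rightarrow> tm \<Rightarrow> tm \<Rightarrow> tm \<Rightarrow> tm \<Rightarrow> tm \<Rightarrow> tm \<Rightarrow> fm" where
  "ZL_matrix X lt P ub N M W n v g =
    (Pbar X P ub n \<^bold>\<longrightarrow>
      Pbar X P v (N \<cdot> v \<cdot> g) \<^bold>\<and> Cf X lt P v g (M \<cdot> v \<cdot> g) (W \<cdot> v \<cdot> g))"

text \<open>Names bound in formulas and terms that have \<open>P\<close> in their scope. A predicate with parameters
  is admitted as long as its parameters are named apart from these; without parameters there is
  no restriction.\<close>

definition bound_names :: "string set" where
  "bound_names = {''ub'', ''N'', ''M'', ''W'', ''i'', ''r'', ''j'', ''k'', ''n'', ''v'', ''g''}"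

definition qf_predicate :: "ty \<Rightarrow> fm \<Rightarrow> bool" where
  "qf_predicate X P \<longleftrightarrow> wff [TSeq X] P \<and> qf P \<and> (\<forall>(x, Z) \<in> fv_fm P. x \<notin> bound_names)"

end

theory Submission
  imports Defs "HOL-Library.Countable"
begin

text \<open>
  The argument runs inside a model of the theory; the recursor equation carries all of it. Write
  \<open>\<alpha>\<^sup>u\<close> for the sequence of pairs in that equation at the argument \<open>u\<close>. Cutting \<open>u\<close> at \<open>m\<close>
  cuts \<open>\<alpha>\<^sup>u\<close> at \<open>m\<close>: entries before the cut depend only on the initial segment of \<open>u\<close>, and
  at later entries the first component is the zero object, below which there is nothing, so that the
  second component is zero as well (\<open>eor_arg_ext\<close>). Hence, if the control \<open>F\<close> satisfies
  \<open>F \<alpha>\<^sup>u = f u\<close> for all \<open>u\<close>, it stops \<open>\<alpha>\<^sup>u\<close> exactly where \<open>f\<close> stops \<open>u\<close>,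
  and the recursor equation becomes \<open>EOR u = H \<alpha>\<^sup>v\<close> with \<open>v = spec u f\<close> (\<open>eor_spec\<close>). This is used for two functionals, both with
  \<open>f = \<phi>\<close>.

  For \<open>\<Psi>\<close> it gives \<open>\<Psi> u = \<phi> (spec u \<phi>)\<close> (\<open>Psi_eq\<close>). If \<open>P\<close> holds of \<open>[u](\<Psi> u)\<close> and
  \<open>v = spec u \<phi>\<close>, then \<open>P\<close> holds of \<open>[v](\<phi> v)\<close>, because \<open>v\<close> is \<open>u\<close> or is \<open>u\<close> cut at a point
  beyond \<open>\<phi> v\<close> (\<open>Pbar_spec\<close>). If \<open>C\<^sub>0\<close> fails at \<open>v\<close>, the failure says that \<open>P\<close> holds of
  \<open>[\<xi> v](\<Psi> (\<xi> v))\<close> (\<open>Pbar_xi\<close>). So the property passes along the sequence \<open>u\<^sub>i\<close> up to the first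
  index \<open>k\<close> with \<open>C\<^sub>0\<close>, where it is the claim.

  The index \<open>k\<close> exists because the number of remaining steps is itself computed by the recursor:
  there is a functional \<open>E\<close> with \<open>E u = 1 + E (\<xi> v)\<close> whenever \<open>C\<^sub>0\<close> fails at \<open>v = spec u \<phi>\<close>
  (\<open>step_counter\<close>). If \<open>C\<^sub>0\<close> failed at every stage, the numbers \<open>E u\<^sub>i\<close> would descend forever, against
  induction.

  To turn this into a derivation in the calculus, it is shown that a formula is provable if it belongs to
  every maximal consistent theory with witnesses (\<open>completeness\<close>). The closed terms modulo the
  equations of such a theory form a model: its connectives and quantifiers are those of HOL,
  provable equality is equality of values, functions are extensional, and induction holds for every predicate that a
  formula with parameters defines (\<open>nat_induction\<close>). Bound names are interpreted through
  environments, so that the named definitions of the theory can be evaluated by rewriting.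
\<close>

section \<open>Substitution and typing\<close>

text \<open>Free variables are replaced simultaneously, by terms without dangling indices. With one
  substitution after the other, a name that occurs in an earlier replacement would be caught by a
  later one.\<close>

primrec msub_tm :: "(string \<times> ty \<Rightarrow> tm) \<Rightarrow> tm \<Rightarrow> tm" where
  "msub_tm \<rho> (Bnd i) = Bnd i"
| "msub_tm \<rho> (Fre x Z) = \<rho> (x, Z)"
| "msub_tm \<rho> (Cst c) = Cst c"
| "msub_tm \<rho> (s \<cdot> t) = msub_tm \<rho> s \<cdot> msub_tm \<rho> t"
| "msub_tm \<rho> (Lam Z t) = Lam Z (msub_tm \<rho> t)"

primrec msub_fm :: "(string \<times> ty \<Rightarrow> tm) \<Rightarrow> fm \<Rightarrow> fm" where
  "msub_fm \<rho> (Eq Z s t) = Eq Z (msub_tm \<rho> s) (msub_tm \<rho> t)"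
| "msub_fm \<rho> \<^bold>\<bottom> = \<^bold>\<bottom>"
| "msub_fm \<rho> (A \<^bold>\<longrightarrow> B) = (msub_fm \<rho> A \<^bold>\<longrightarrow> msub_fm \<rho> B)"
| "msub_fm \<rho> (All Z A) = All Z (msub_fm \<rho> A)"

definition wt_env :: "(string \<times> ty \<Rightarrow> tm) \<Rightarrow> bool" where
  "wt_env \<rho> \<longleftrightarrow> (\<forall>x Z. wt [] (\<rho> (x, Z)) Z)"

abbreviation id_env :: "string \<times> ty \<Rightarrow> tm" where
  "id_env \<equiv> \<lambda>(x, Z). Fre x Z"

lemma wt_unique: "wt \<Gamma> t Z \<Longrightarrow> wt \<Gamma> t Y \<Longrightarrow> Z = Y"
  by (induction t arbitrary: \<Gamma> Z Y) fastforce+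

lemma wt_append: "wt \<Gamma> t Z \<Longrightarrow> wt (\<Gamma> @ \<Gamma>') t Z"
  by (induction t arbitrary: \<Gamma> Z) (fastforce simp: nth_append)+

lemma wt_weaken: "wt [] t Z \<Longrightarrow> wt \<Gamma> t Z"
  using wt_append[of "[]"] by simp

lemma wff_append: "wff \<Gamma> A \<Longrightarrow> wff (\<Gamma> @ \<Gamma>') A"
  by (induction A arbitrary: \<Gamma>) (fastforce simp: wt_append)+

lemma inst_tm_closed: "wt \<Gamma> t Z \<Longrightarrow> length \<Gamma> \<le> k \<Longrightarrow> inst_tm k u t = t"
  by (induction t arbitrary: \<Gamma> Z k) fastforce+

lemma inst_fm_closed: "wff \<Gamma> A \<Longrightarrow> length \<Gamma> \<le> k \<Longrightarrow> inst_fm k u A = A"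
proof (induction A arbitrary: \<Gamma> k)
  case (All Z A)
  then show ?case by (metis Suc_le_mono inst_fm.simps(4) length_Cons wff.simps(4))
qed (auto simp: inst_tm_closed)

lemma wt_inst: "wt (\<Gamma> @ [Y]) t Z \<Longrightarrow> wt [] u Y \<Longrightarrow> wt \<Gamma> (inst_tm (length \<Gamma>) u t) Z"
proof (induction t arbitrary: \<Gamma> Z)
  case (Bnd i)
  then show ?case by (auto simp: nth_append wt_weaken split: if_splits)
next
  case (Lam V t)
  then show ?case using Lam.IH[of "V # \<Gamma>"] by auto
next
  case (App s t)
  then show ?case by simp blast
qed auto

lemma wff_inst: "wff (\<Gamma> @ [Y]) A \<Longrightarrow> wt [] u Y \<Longrightarrow> wff \<Gamma> (inst_fm (length \<Gamma>) u A)"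
proof (induction A arbitrary: \<Gamma>)
  case (All V A)
  then show ?case using All.IH[of "V # \<Gamma>"] by auto
qed (auto simp: wt_inst)

lemma wff_fill: "wff [Y] A \<Longrightarrow> wt [] u Y \<Longrightarrow> wff [] (A\<lbrakk>u\<rbrakk>)"
  using wff_inst[of "[]"] by simp

lemma wt_abs: "wt \<Gamma> t Z \<Longrightarrow> wt (\<Gamma> @ [Y]) (abs_tm (length \<Gamma>) x Y t) Z"
proof (induction t arbitrary: \<Gamma> Z)
  case (Lam V t)
  then show ?case using Lam.IH[of "V # \<Gamma>"] by auto
next
  case (App s t)
  then show ?case by simp blast
qed (auto simp: nth_append)

lemma wff_abs: "wff \<Gamma> A \<Longrightarrow> wff (\<Gamma> @ [Y]) (abs_fm (length \<Gamma>) x Y A)"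
proof (induction A arbitrary: \<Gamma>)
  case (All V A)
  then show ?case using All.IH[of "V # \<Gamma>"] by auto
qed (auto simp: wt_abs)

lemma wt_msub: "wt \<Gamma> t Z \<Longrightarrow> wt_env \<rho> \<Longrightarrow> wt \<Gamma> (msub_tm \<rho> t) Z"
  by (induction t arbitrary: \<Gamma> Z) (fastforce simp: wt_env_def wt_weaken)+

lemma wff_msub: "wff \<Gamma> A \<Longrightarrow> wt_env \<rho> \<Longrightarrow> wff \<Gamma> (msub_fm \<rho> A)"
  by (induction A arbitrary: \<Gamma>) (auto simp: wt_msub)

lemma wt_env_closed: "wt_env \<rho> \<Longrightarrow> inst_tm k u (\<rho> (x, Z)) = \<rho> (x, Z)"
  unfolding wt_env_def by (metis inst_tm_closed le0 list.size(3))

lemma msub_inst_tm: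
  "wt_env \<rho> \<Longrightarrow> msub_tm \<rho> (inst_tm k u t) = inst_tm k (msub_tm \<rho> u) (msub_tm \<rho> t)"
  by (induction t arbitrary: k) (auto simp: wt_env_closed)

lemma msub_inst_fm:
  "wt_env \<rho> \<Longrightarrow> msub_fm \<rho> (inst_fm k u A) = inst_fm k (msub_tm \<rho> u) (msub_fm \<rho> A)"
  by (induction A arbitrary: k) (auto simp: msub_inst_tm)

text \<open>Opening a named binder: since substitution is simultaneous, the substituted terms may contain
  the bound name without being captured.\<close>

lemma inst_msub_abs_tm:
  "wt \<Gamma> t Z \<Longrightarrow> length \<Gamma> \<le> k \<Longrightarrow> wt_env \<rho> \<Longrightarrow>
    inst_tm k u (msub_tm \<rho> (abs_tm k x Y t)) = msub_tm (\<rho>((x, Y) := u)) t"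
proof (induction t arbitrary: \<Gamma> Z k)
  case (Lam V t)
  then show ?case using Lam.IH[of "V # \<Gamma>"] by auto
qed (fastforce simp: wt_env_closed)+

lemma inst_msub_abs_fm:
  "wff \<Gamma> A \<Longrightarrow> length \<Gamma> \<le> k \<Longrightarrow> wt_env \<rho> \<Longrightarrow>
    inst_fm k u (msub_fm \<rho> (abs_fm k x Y A)) = msub_fm (\<rho>((x, Y) := u)) A"
proof (induction A arbitrary: \<Gamma> k)
  case (All V A)
  then show ?case using All.IH[of "V # \<Gamma>"] by auto
qed (auto simp: inst_msub_abs_tm)

lemma msub_tm_cong: "(\<And>y. y \<in> fv_tm t \<Longrightarrow> \<rho> y = \<sigma> y) \<Longrightarrow> msub_tm \<rho> t = msub_tm \<sigma> t"
  by (induction t) auto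

lemma msub_fm_cong: "(\<And>y. y \<in> fv_fm A \<Longrightarrow> \<rho> y = \<sigma> y) \<Longrightarrow> msub_fm \<rho> A = msub_fm \<sigma> A"
  by (induction A) (auto intro!: msub_tm_cong)

lemma msub_id_tm [simp]: "msub_tm id_env t = t"
  by (induction t) auto

lemma msub_id_fm [simp]: "msub_fm id_env A = A"
  by (induction A) auto

lemma wt_env_id [simp]: "wt_env id_env"
  by (simp add: wt_env_def)

lemma wt_env_upd [intro]: "wt_env \<rho> \<Longrightarrow> wt [] u Y \<Longrightarrow> wt_env (\<rho>((x, Y) := u))"
  by (auto simp: wt_env_def)

lemma fv_abs_tm: "fv_tm (abs_tm k x Y t) = fv_tm t - {(x, Y)}"
  by (induction t arbitrary: k) auto

lemma finite_fv_tm: "finite (fv_tm t)"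
  by (induction t) auto

lemma finite_fv_fm: "finite (fv_fm A)"
  by (induction A) (auto simp: finite_fv_tm)

lemma wff_Neg [simp]: "wff \<Gamma> (\<^bold>\<not> A) = wff \<Gamma> A"
  by (simp add: Neg_def)

lemma wff_Conj [simp]: "wff \<Gamma> (A \<^bold>\<and> B) = (wff \<Gamma> A \<and> wff \<Gamma> B)"
  by (simp add: Conj_def)

lemma wff_Disj [simp]: "wff \<Gamma> (A \<^bold>\<or> B) = (wff \<Gamma> A \<and> wff \<Gamma> B)"
  by (simp add: Disj_def)

lemma fresh_name: 
  assumes "finite (F :: (string \<times> ty) set)"
  shows "\<exists>x. \<forall>Z. (x, Z) \<notin> F"
proof -
  have "finite (fst ` F)" using assms by simp
  then obtain x where "x \<notin> fst ` F"
    using ex_new_if_finite infinite_UNIV_listI by blast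
  then show ?thesis by (force simp: image_iff)
qed


section \<open>Completeness\<close>

text \<open>The usual construction of Lindenbaum and Henkin, with free variables as witnesses. At every stage
  only finitely many formulas have been added, hence a fresh variable is always available. Each stage is a list
  of hypotheses that are kept as premises of a formula derived from no hypotheses. The deduction
  theorem then holds by definition and weakening is the axiom K; weakening a derivation itself would
  require renaming its eigenvariables.\<close>

instance ty :: countable by countable_datatype
instance cst :: countable by countable_datatype
instance tm :: countable by countable_datatype
instance fm :: countable by countable_datatype

text \<open>The latest hypothesis is the innermost premise, so that adding one to the list amounts to an
  implication under the earlier ones.\<close>

primrec imps :: "fm list \<Rightarrow> fm \<Rightarrow> fm" where
  "imps [] C = C"
| "imps (B # l) C = imps l (B \<^bold>\<longrightarrow> C)"

context
  fixes Ax :: "fm set"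
begin

abbreviation prov :: "fm \<Rightarrow> bool" where "prov A \<equiv> deriv Ax {} A"

definition derives :: "fm list \<Rightarrow> fm \<Rightarrow> bool" where
  "derives l A \<longleftrightarrow> prov (imps l A)"

lemma prov_K: "wff [] A \<Longrightarrow> wff [] B \<Longrightarrow> prov (A \<^bold>\<longrightarrow> B \<^bold>\<longrightarrow> A)"
  by (intro d_impI) (auto intro: d_hyp)

lemma prov_S:
  assumes "wff [] A" "wff [] B" "wff [] C"
  shows "prov ((A \<^bold>\<longrightarrow> B \<^bold>\<longrightarrow> C) \<^bold>\<longrightarrow> (A \<^bold>\<longrightarrow> B) \<^bold>\<longrightarrow> A \<^bold>\<longrightarrow> C)"
proof (intro d_impI)
  let ?D = "{A, A \<^bold>\<longrightarrow> B, A \<^bold>\<longrightarrow> B \<^bold>\<longrightarrow> C}"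
  have "deriv Ax ?D A" "deriv Ax ?D (A \<^bold>\<longrightarrow> B)" "deriv Ax ?D (A \<^bold>\<longrightarrow> B \<^bold>\<longrightarrow> C)"
    using assms by (auto intro: d_hyp)
  then show "deriv Ax ?D C" by (meson d_impE)
qed (use assms in auto)

lemma prov_DN:
  assumes "wff [] A"
  shows "prov ((\<^bold>\<not> \<^bold>\<not> A) \<^bold>\<longrightarrow> A)"
proof -
  let ?D = "{\<^bold>\<not> A, \<^bold>\<not> \<^bold>\<not> A}"
  have "deriv Ax ?D (\<^bold>\<not> A)" "deriv Ax ?D ((\<^bold>\<not> A) \<^bold>\<longrightarrow> \<^bold>\<bottom>)"
    using assms by (auto intro!: d_hyp simp: Neg_def)
  then have "deriv Ax ?D \<^bold>\<bottom>" by (meson d_impE)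
  then have "deriv Ax {\<^bold>\<not> \<^bold>\<not> A} A" using assms by (intro d_classical[of A])
  then show ?thesis using assms by (intro d_impI) auto
qed

lemma prov_All_imp:
  assumes "wff [] B" "wff [Z] C"
  shows "prov (All Z (B \<^bold>\<longrightarrow> C) \<^bold>\<longrightarrow> B \<^bold>\<longrightarrow> All Z C)"
proof -
  let ?D = "{B, All Z (B \<^bold>\<longrightarrow> C)}"
  obtain x where x: "\<forall>V. (x, V) \<notin> fv_fm B \<union> fv_fm C"
    using fresh_name[of "fv_fm B \<union> fv_fm C"] by (auto simp: finite_fv_fm)
  have B: "wff [Z] B" "\<And>k u. inst_fm k u B = B"
    using assms wff_append[of "[]"] inst_fm_closed by fastforce+
  have "deriv Ax ?D (All Z (B \<^bold>\<longrightarrow> C))" "deriv Ax ?D B"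
    using assms B by (auto intro!: d_hyp)
  then have "deriv Ax ?D (C\<lbrakk>Fre x Z\<rbrakk>)"
    using d_allE[of Ax ?D Z "B \<^bold>\<longrightarrow> C" "Fre x Z"] B by (auto intro: d_impE)
  then have "deriv Ax ?D (All Z C)"
    using x assms by (intro d_allI[where x = x]) auto
  then show ?thesis using assms B by (intro d_impI) auto
qed

lemma prov_inst:
  assumes "wff [Z] A" "wt [] t Z"
  shows "prov (All Z A \<^bold>\<longrightarrow> A\<lbrakk>t\<rbrakk>)"
  using assms by (intro d_impI d_allE[of _ _ Z]) (auto intro: d_hyp)

lemma prov_Leibniz:
  assumes "wff [Z] A" "wt [] s Z" "wt [] t Z"
  shows "prov (Eq Z s t \<^bold>\<longrightarrow> A\<lbrakk>s\<rbrakk> \<^bold>\<longrightarrow> A\<lbrakk>t\<rbrakk>)"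
  using assms wff_fill[of Z A s]
  by (intro d_impI d_subst[of _ _ Z s t A]) (auto intro: d_hyp)

lemma pr_prov: "prov A \<Longrightarrow> wff [] A \<Longrightarrow> \<forall>B\<in>set l. wff [] B \<Longrightarrow> derives l A"
proof (induction l arbitrary: A)
  case (Cons B l)
  have "prov (B \<^bold>\<longrightarrow> A)" using prov_K[of A B] Cons.prems by (auto intro: d_impE)
  then show ?case using Cons.IH[of "B \<^bold>\<longrightarrow> A"] Cons.prems by (simp add: derives_def)
qed (simp add: derives_def)

lemma pr_mp:
  "derives l (A \<^bold>\<longrightarrow> B) \<Longrightarrow> derives l A \<Longrightarrow> wff [] A \<Longrightarrow> wff [] B \<Longrightarrow> \<forall>B\<in>set l. wff [] B \<Longrightarrow> derives l B"
proof (induction l arbitrary: A B)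
  case Nil
  then show ?case by (auto simp: derives_def intro: d_impE)
next
  case (Cons D l)
  have "derives l ((D \<^bold>\<longrightarrow> A \<^bold>\<longrightarrow> B) \<^bold>\<longrightarrow> (D \<^bold>\<longrightarrow> A) \<^bold>\<longrightarrow> D \<^bold>\<longrightarrow> B)"
    using Cons.prems by (intro pr_prov prov_S) auto
  moreover have "derives l (D \<^bold>\<longrightarrow> A \<^bold>\<longrightarrow> B)" "derives l (D \<^bold>\<longrightarrow> A)"
    using Cons.prems by (auto simp: derives_def)
  ultimately have "derives l (D \<^bold>\<longrightarrow> B)"
    using Cons.IH Cons.prems by (metis list.set_intros(1,2) wff.simps(3))
  then show ?case by (simp add: derives_def)
qed

lemma pr_weaken:
  assumes "derives l A" "wff [] A" "\<forall>B\<in>set l. wff [] B" "wff [] B"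
  shows "derives (B # l) A"
proof -
  have "derives l (A \<^bold>\<longrightarrow> B \<^bold>\<longrightarrow> A)" using assms by (intro pr_prov prov_K) auto
  then have "derives l (B \<^bold>\<longrightarrow> A)" using assms pr_mp by (metis wff.simps(3))
  then show ?thesis by (simp add: derives_def)
qed

lemma pr_self:
  assumes "\<forall>B\<in>set l. wff [] B" "wff [] B"
  shows "derives (B # l) B"
proof -
  have "prov (B \<^bold>\<longrightarrow> B)" using assms by (intro d_impI) (auto intro: d_hyp)
  then have "derives l (B \<^bold>\<longrightarrow> B)" using assms by (intro pr_prov) auto
  then show ?thesis by (simp add: derives_def)
qed

text \<open>Generalisation under hypotheses reduces to generalisation without any, since a universal
  quantifier can be pulled through a closed premise.\<close>

lemma pr_generalise:
  "derives l (C\<lbrakk>Fre x Z\<rbrakk>) \<Longrightarrow> wff [Z] C \<Longrightarrow> (x, Z) \<notin> fv_fm C \<Longrightarrow>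
    \<forall>B\<in>set l. wff [] B \<and> (x, Z) \<notin> fv_fm B \<Longrightarrow> derives l (All Z C)"
proof (induction l arbitrary: C)
  case Nil
  then show ?case by (auto simp: derives_def intro: d_allI)
next
  case (Cons B l)
  have B: "wff [] B" "wff [Z] B" "\<And>k u. inst_fm k u B = B" 
    using Cons.prems wff_append[of "[]" B "[Z]"] inst_fm_closed by fastforce+
  have "derives l (All Z (B \<^bold>\<longrightarrow> C))"
    using Cons.IH[of "B \<^bold>\<longrightarrow> C"] Cons.prems B by (auto simp: derives_def)
  moreover have "derives l (All Z (B \<^bold>\<longrightarrow> C) \<^bold>\<longrightarrow> B \<^bold>\<longrightarrow> All Z C)"
    using Cons.prems B by (intro pr_prov prov_All_imp) auto
  ultimately have "derives l (B \<^bold>\<longrightarrow> All Z C)"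
    using pr_mp Cons.prems B by (metis list.set_intros(2) wff.simps(3,4))
  then show ?case by (simp add: derives_def)
qed

definition consistent :: "fm list \<Rightarrow> bool" where
  "consistent l \<longleftrightarrow> (\<forall>B\<in>set l. wff [] B) \<and> \<not> derives l \<^bold>\<bottom>"

lemma con_extend:
  assumes "consistent l" "wff [] B"
  shows "consistent (B # l) \<or> consistent ((\<^bold>\<not> B) # l)"
  using assms pr_mp[of l "\<^bold>\<not> B" "\<^bold>\<bottom>"] by (auto simp: consistent_def derives_def Neg_def)

text \<open>If \<open>\<not> C x\<close> were inconsistent with the hypotheses, then \<open>C x\<close> would be derivable from them for
  a fresh \<open>x\<close>, and so would \<open>\<forall>x. C x\<close>, whose negation is derivable too.\<close>

lemma con_witness:
  assumes "consistent l" "derives l (\<^bold>\<not> All Z C)" "wff [Z] C" "(x, Z) \<notin> fv_fm C" "\<forall>B\<in>set l. (x, Z) \<notin> fv_fm B"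
  shows "consistent ((\<^bold>\<not> C\<lbrakk>Fre x Z\<rbrakk>) # l)"
proof (rule ccontr)
  have w: "wff [] (C\<lbrakk>Fre x Z\<rbrakk>)" using assms wff_fill by simp
  have l: "\<forall>B\<in>set l. wff [] B" using assms by (simp add: consistent_def)
  assume "\<not> ?thesis"
  then have "derives l (\<^bold>\<not> \<^bold>\<not> C\<lbrakk>Fre x Z\<rbrakk>)" using w l by (auto simp: consistent_def derives_def Neg_def)
  moreover have "derives l ((\<^bold>\<not> \<^bold>\<not> C\<lbrakk>Fre x Z\<rbrakk>) \<^bold>\<longrightarrow> C\<lbrakk>Fre x Z\<rbrakk>)"
    using w l by (intro pr_prov prov_DN) auto
  ultimately have "derives l (C\<lbrakk>Fre x Z\<rbrakk>)" using pr_mp w l by (metis wff_Neg)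
  then have "derives l (All Z C)" using assms l by (intro pr_generalise) auto
  then have "derives l \<^bold>\<bottom>" using assms l pr_mp by (metis Neg_def wff.simps(2,4))
  then show False using assms by (simp add: consistent_def)
qed

definition fresh :: "fm list \<Rightarrow> string" where
  "fresh l = (SOME x. \<forall>Z. \<forall>B\<in>set l. (x, Z) \<notin> fv_fm B)"

lemma fresh: "\<forall>B\<in>set l. (fresh l, Z) \<notin> fv_fm B"
proof -
  have "finite (\<Union>B\<in>set l. fv_fm B)" by (simp add: finite_fv_fm)
  then obtain x where "\<forall>Z. (x, Z) \<notin> (\<Union>B\<in>set l. fv_fm B)" using fresh_name by blast
  then have "\<exists>x. \<forall>Z. \<forall>B\<in>set l. (x, Z) \<notin> fv_fm B" by auto
  then show ?thesis unfolding fresh_def by (rule someI2_ex) blast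
qed

text \<open>The pattern is \<open>\<^bold>\<not> All Z C\<close> with negation unfolded.\<close>

fun with_witness :: "fm list \<Rightarrow> fm list" where
  "with_witness ((All Z C \<^bold>\<longrightarrow> \<^bold>\<bottom>) # l) =
     (\<^bold>\<not> C\<lbrakk>Fre (fresh ((All Z C \<^bold>\<longrightarrow> \<^bold>\<bottom>) # l)) Z\<rbrakk>) # (All Z C \<^bold>\<longrightarrow> \<^bold>\<bottom>) # l"
| "with_witness l = l"

lemma con_with_witness: "consistent l \<Longrightarrow> consistent (with_witness l)"
proof (induction l rule: with_witness.induct)
  case (1 Z C l)
  let ?l = "(All Z C \<^bold>\<longrightarrow> \<^bold>\<bottom>) # l"
  have "derives ?l (All Z C \<^bold>\<longrightarrow> \<^bold>\<bottom>)" "wff [Z] C"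
    using 1 by (auto simp: consistent_def intro!: pr_self)
  then show ?case using 1 fresh[of ?l Z] con_witness[of ?l Z C "fresh ?l"] by (simp add: Neg_def)
qed auto

lemma with_witness_extends: "\<exists>l'. with_witness l = l' @ l"
  by (induction l rule: with_witness.induct) auto

context
  fixes A0 :: fm
  assumes A0: "wff [] A0" "\<not> prov A0"
begin

primrec stage :: "nat \<Rightarrow> fm list" where
  "stage 0 = [\<^bold>\<not> A0]"
| "stage (Suc n) = (let B = from_nat n; l = stage n in
     if \<not> wff [] B then l else if consistent (B # l) then with_witness (B # l) else (\<^bold>\<not> B) # l)"

lemma con_stage: "consistent (stage n)"
proof (induction n)
  case 0
  have "prov A0" if "prov (\<^bold>\<not> \<^bold>\<not> A0)" using that prov_DN A0 d_impE by blast
  then show ?case using A0 by (auto simp: consistent_def derives_def Neg_def)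
next
  case (Suc n)
  then show ?case using con_extend[of "stage n" "from_nat n"] con_with_witness by (auto simp: Let_def)
qed

lemma stage_extends: "\<exists>l'. stage (Suc n) = l' @ stage n"
  using with_witness_extends[of "from_nat n # stage n"] by (auto simp: Let_def)

lemma pr_extend: "derives l A \<Longrightarrow> wff [] A \<Longrightarrow> \<forall>B\<in>set (l' @ l). wff [] B \<Longrightarrow> derives (l' @ l) A"
  by (induction l') (auto intro: pr_weaken)

lemma pr_stage_mono: "n \<le> m \<Longrightarrow> derives (stage n) A \<Longrightarrow> wff [] A \<Longrightarrow> derives (stage m) A"
proof (induction rule: dec_induct)
  case (step m)
  then show ?case using stage_extends[of m] con_stage[of "Suc m"] pr_extend consistent_def by metis
qed

definition limit_theory :: "fm set" where
  "limit_theory = {B. wff [] B \<and> (\<exists>n. derives (stage n) B)}"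

lemma wff_stage: "B \<in> set (stage n) \<Longrightarrow> wff [] B"
  using con_stage consistent_def by blast

lemma Th_prov: "prov B \<Longrightarrow> wff [] B \<Longrightarrow> B \<in> limit_theory"
  by (auto simp: limit_theory_def intro!: exI[of _ 0] pr_prov wff_stage)

lemma Th_mp: "(A \<^bold>\<longrightarrow> B) \<in> limit_theory \<Longrightarrow> A \<in> limit_theory \<Longrightarrow> B \<in> limit_theory"
proof -
  assume "(A \<^bold>\<longrightarrow> B) \<in> limit_theory" "A \<in> limit_theory"
  then obtain n m where *: "wff [] A" "wff [] B" "derives (stage n) (A \<^bold>\<longrightarrow> B)" "derives (stage m) A"
    by (auto simp: limit_theory_def)
  then have "derives (stage (max n m)) (A \<^bold>\<longrightarrow> B)" "derives (stage (max n m)) A"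
    by (auto intro: pr_stage_mono[of n] pr_stage_mono[of m])
  then show "B \<in> limit_theory" using * pr_mp wff_stage limit_theory_def by blast
qed

lemma Th_bot: "\<^bold>\<bottom> \<notin> limit_theory"
  using con_stage by (auto simp: limit_theory_def consistent_def)

lemma stage_hd: "stage n = B # l \<Longrightarrow> B \<in> limit_theory"
  using pr_self[of l B] wff_stage[of _ n] by (auto simp: limit_theory_def intro!: exI[of _ n])

text \<open>Every formula is treated at the stage given by its number: it is either added there, or it is
  inconsistent with that stage and its negation is added.\<close>

lemma Th_complete: "wff [] B \<Longrightarrow> B \<in> limit_theory \<or> (\<^bold>\<not> B) \<in> limit_theory"
proof -
  assume B: "wff [] B"
  show ?thesis
  proof (cases "consistent (B # stage (to_nat B))")
    case True
    then have "stage (Suc (to_nat B)) = with_witness (B # stage (to_nat B))" using B by simp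
    moreover have "derives (B # stage (to_nat B)) B" using B wff_stage by (auto intro: pr_self)
    ultimately show ?thesis
      using B con_stage[of "Suc (to_nat B)"] pr_extend with_witness_extends
      unfolding limit_theory_def consistent_def by (metis (mono_tags, lifting) mem_Collect_eq)
  next
    case False
    then show ?thesis using B stage_hd[of "Suc (to_nat B)"] by simp
  qed
qed

lemma Th_Neg: "wff [] B \<Longrightarrow> (\<^bold>\<not> B) \<in> limit_theory \<longleftrightarrow> B \<notin> limit_theory"
  using Th_complete Th_mp Th_bot by (auto simp: Neg_def)

lemma Th_Imp: 
  assumes "wff [] A" "wff [] B"
  shows "(A \<^bold>\<longrightarrow> B) \<in> limit_theory \<longleftrightarrow> (A \<in> limit_theory \<longrightarrow> B \<in> limit_theory)"
proof
  assume *: "A \<in> limit_theory \<longrightarrow> B \<in> limit_theory"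
  show "(A \<^bold>\<longrightarrow> B) \<in> limit_theory"
  proof (cases "B \<in> limit_theory")
    case True
    then show ?thesis using assms Th_mp Th_prov[OF prov_K[of B A]] by auto
  next
    case False
    then have "(\<^bold>\<not> A) \<in> limit_theory" using * assms Th_Neg by auto
    moreover have "prov ((\<^bold>\<not> A) \<^bold>\<longrightarrow> A \<^bold>\<longrightarrow> B)"
    proof -
      let ?D = "{\<^bold>\<not> B, A, \<^bold>\<not> A}"
      have "deriv Ax ?D (A \<^bold>\<longrightarrow> \<^bold>\<bottom>)" "deriv Ax ?D A"
        using assms by (auto intro!: d_hyp simp: Neg_def)
      then have "deriv Ax ?D \<^bold>\<bottom>" by (meson d_impE)
      then have "deriv Ax {A, \<^bold>\<not> A} B" using assms by (intro d_classical[of B])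
      then show ?thesis using assms by (intro d_impI) auto
    qed
    ultimately show ?thesis using Th_mp Th_prov assms by (metis wff.simps(3) wff_Neg)
  qed
qed (use Th_mp in blast)

lemma Th_All:
  assumes "wff [Z] C"
  shows "All Z C \<in> limit_theory \<longleftrightarrow> (\<forall>t. wt [] t Z \<longrightarrow> C\<lbrakk>t\<rbrakk> \<in> limit_theory)"
proof
  assume "All Z C \<in> limit_theory"
  then show "\<forall>t. wt [] t Z \<longrightarrow> C\<lbrakk>t\<rbrakk> \<in> limit_theory"
    using assms Th_mp Th_prov[OF prov_inst[of Z C]] wff_fill by auto
next
  assume *: "\<forall>t. wt [] t Z \<longrightarrow> C\<lbrakk>t\<rbrakk> \<in> limit_theory"
  show "All Z C \<in> limit_theory"
  proof (rule ccontr)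
    let ?B = "All Z C \<^bold>\<longrightarrow> \<^bold>\<bottom>" let ?n = "to_nat ?B"
    have B: "wff [] ?B" using assms by simp
    assume "All Z C \<notin> limit_theory"
    then have "?B \<in> limit_theory" using Th_Neg[of "All Z C"] assms by (simp add: Neg_def)
    then have "(\<^bold>\<not> ?B) \<notin> limit_theory" using Th_Neg[of "?B"] B by simp
    then have "consistent (?B # stage ?n)"
      using stage_hd[of "Suc ?n" "\<^bold>\<not> ?B" "stage ?n"] B
      by (cases "consistent (?B # stage ?n)") (auto simp: Let_def)
    then have "stage (Suc ?n) = with_witness (?B # stage ?n)" using B by (simp add: Let_def)
    then obtain x where "(\<^bold>\<not> C\<lbrakk>Fre x Z\<rbrakk>) \<in> limit_theory" using stage_hd[of "Suc ?n"] by auto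
    then show False using * Th_Neg assms wff_fill by (metis wt.simps(2))
  qed
qed

end

end

text \<open>What the model needs of the limit theory: it settles every implication, and a universal formula
  outside it has a closed term as counterexample.\<close>

definition henkin :: "fm set \<Rightarrow> fm set \<Rightarrow> bool" where
  "henkin Ax T \<longleftrightarrow>
    (\<forall>A. deriv Ax {} A \<longrightarrow> wff [] A \<longrightarrow> A \<in> T) \<and>
    \<^bold>\<bottom> \<notin> T \<and>
    (\<forall>A B. wff [] A \<longrightarrow> wff [] B \<longrightarrow> (A \<^bold>\<longrightarrow> B) \<in> T \<longleftrightarrow> (A \<in> T \<longrightarrow> B \<in> T)) \<and>
    (\<forall>Z A. wff [Z] A \<longrightarrow> All Z A \<in> T \<longleftrightarrow> (\<forall>t. wt [] t Z \<longrightarrow> A\<lbrakk>t\<rbrakk> \<in> T))"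

text \<open>If \<open>A\<close> is not derivable, the construction can start from \<open>\<^bold>\<not> A\<close>, and the limit theory does not
  contain \<open>A\<close>.\<close>

theorem completeness:
  assumes A: "wff [] A" and T: "\<And>T. henkin Ax T \<Longrightarrow> A \<in> T"
  shows "deriv Ax {} A"
proof (rule ccontr)
  assume n: "\<not> deriv Ax {} A"
  have "henkin Ax (limit_theory Ax A)"
    using Th_prov[OF A n] Th_bot[OF A n] Th_Imp[OF A n] Th_All[OF A n] by (simp add: henkin_def)
  then have "A \<in> limit_theory Ax A" by (rule T)
  moreover have "(\<^bold>\<not> A) \<in> limit_theory Ax A" using stage_hd[OF A n, of 0 "\<^bold>\<not> A" "[]"] stage.simps(1)[OF A n] by simp
  ultimately show False using Th_Neg[OF A n] A by simp
qed


section \<open>The term model\<close>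

text \<open>Typing as a partial function. Rewriting computes the type of a concrete term with it, without
  having to guess the argument types of applications; this discharges the typing conditions of
  all laws of the model.\<close>

definition tp :: "tm \<Rightarrow> ty option" where
  "tp t = (if \<exists>Z. wt [] t Z then Some (THE Z. wt [] t Z) else None)"

fun tp_app :: "ty option \<Rightarrow> ty option \<Rightarrow> ty option" where
  "tp_app (Some (Y \<rightarrow> Z)) (Some V) = (if V = Y then Some Z else None)"
| "tp_app _ _ = None"

lemma wt_tp: "wt [] t Z \<longleftrightarrow> tp t = Some Z"
  using wt_unique[of "[]" t] by (auto simp: tp_def intro: theI2)

lemma tp_app_Some: "tp_app a b = Some Z \<longleftrightarrow> (\<exists>Y. a = Some (Y \<rightarrow> Z) \<and> b = Some Y)"
  by (induction a b rule: tp_app.induct) auto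

lemma tp_eqI: "(\<And>Z. wt [] s Z \<longleftrightarrow> wt [] t Z) \<Longrightarrow> tp s = tp t"
proof -
  assume "\<And>Z. wt [] s Z \<longleftrightarrow> wt [] t Z"
  then have "wt [] s = wt [] t" by blast
  then show ?thesis by (simp add: tp_def)
qed

lemma tp_App [simp]: "tp (s \<cdot> t) = tp_app (tp s) (tp t)"
proof -
  have "tp (s \<cdot> t) = Some Z \<longleftrightarrow> tp_app (tp s) (tp t) = Some Z" for Z
    by (simp only: wt_tp[symmetric] tp_app_Some wt.simps)
  then show ?thesis by (metis not_Some_eq)
qed

lemma tp_Fre [simp]: "tp (Fre x Z) = Some Z"
  by (simp add: wt_tp[symmetric])

lemma tp_Cst [simp]: "tp (Cst c) = Some (cst_ty c)"
  by (simp add: wt_tp[symmetric])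

lemma wt_lam: "wt [] (f (Fre x Y)) Z \<Longrightarrow> wt [] (lam x Y f) (Y \<rightarrow> Z)"
  using wt_abs[of "[]"] by (simp add: lam_def)

lemma tp_lam [simp]: "tp (f (Fre x Y)) \<noteq> None \<Longrightarrow> tp (lam x Y f) = Some (Y \<rightarrow> the (tp (f (Fre x Y))))"
  using wt_lam[of f x Y] by (auto simp: wt_tp)

lemma fv_lam [simp]: "fv_tm (lam x Y f) = fv_tm (f (Fre x Y)) - {(x, Y)}"
  by (simp add: lam_def fv_abs_tm)

lemma wff_Eq [simp]: "wff [] (Eq Z s t) \<longleftrightarrow> tp s = Some Z \<and> tp t = Some Z"
  by (simp add: wt_tp)

lemma wff_Tr [simp]: "wff [] (Tr b) \<longleftrightarrow> tp b = Some TB"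
  by (simp add: Tr_def wt_tp)

lemma wff_all [simp]: "wff [] (F (Fre x Z)) \<Longrightarrow> wff [] (all x Z F)"
  using wff_abs[of "[]"] by (simp add: all_def)

lemma wff_ex [simp]: "wff [] (F (Fre x Z)) \<Longrightarrow> wff [] (ex x Z F)"
  by (simp add: ex_def)

lemma wt_zero: "wt \<Gamma> (zero Z) Z"
  by (induction Z arbitrary: \<Gamma>) auto

lemma fv_zero [simp]: "fv_tm (zero Z) = {}"
  by (induction Z) auto

lemma tp_zero [simp]: "tp (zero Z) = Some Z"
  by (simp add: wt_tp[symmetric] wt_zero)

lemma wt_env_upd_tp [simp]: "wt_env \<rho> \<Longrightarrow> tp u = Some Y \<Longrightarrow> wt_env (\<rho>((x, Y) := u))"
  by (simp add: wt_env_upd wt_tp)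

locale henkin_theory =
  fixes X :: ty and lt :: tm and T :: "fm set"
  assumes henkin: "henkin (axs X lt) T"
begin

lemma T_prov: "deriv (axs X lt) {} A \<Longrightarrow> wff [] A \<Longrightarrow> A \<in> T"
  and T_bot: "\<^bold>\<bottom> \<notin> T"
  and T_Imp: "wff [] A \<Longrightarrow> wff [] B \<Longrightarrow> (A \<^bold>\<longrightarrow> B) \<in> T \<longleftrightarrow> (A \<in> T \<longrightarrow> B \<in> T)"
  and T_All: "wff [Z] C \<Longrightarrow> All Z C \<in> T \<longleftrightarrow> (\<forall>t. wt [] t Z \<longrightarrow> C\<lbrakk>t\<rbrakk> \<in> T)"
  using henkin by (simp_all add: henkin_def)

lemma T_axiom: "A \<in> axs X lt \<Longrightarrow> wff [] A \<Longrightarrow> A \<in> T"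
  by (rule T_prov[OF d_axiom])

lemma T_refl: "wt [] t Z \<Longrightarrow> Eq Z t t \<in> T"
  by (rule T_prov[OF d_refl]) (auto simp: wt_tp)

lemma T_subst:
  assumes "Eq Z s t \<in> T" "wff [Z] A" "wt [] s Z" "wt [] t Z" "A\<lbrakk>s\<rbrakk> \<in> T"
  shows "A\<lbrakk>t\<rbrakk> \<in> T"
proof -
  have "(Eq Z s t \<^bold>\<longrightarrow> A\<lbrakk>s\<rbrakk> \<^bold>\<longrightarrow> A\<lbrakk>t\<rbrakk>) \<in> T"
    using assms wff_fill by (intro T_prov prov_Leibniz) (auto simp: wt_tp)
  then show ?thesis using assms wff_fill by (simp add: T_Imp wt_tp)
qed

text \<open>Provable equality, closed under application also of ill-typed terms. Thanks to this closure
  the value of an application is determined by the values of its parts without any typing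
  condition. On well-typed terms nothing is added to provable equality.\<close>

inductive sim :: "tm \<Rightarrow> tm \<Rightarrow> bool" where
  sim_Eq: "wt [] s Z \<Longrightarrow> wt [] t Z \<Longrightarrow> Eq Z s t \<in> T \<Longrightarrow> sim s t"
| sim_refl: "sim t t"
| sim_sym: "sim s t \<Longrightarrow> sim t s"
| sim_trans: "sim s t \<Longrightarrow> sim t u \<Longrightarrow> sim s u"
| sim_App: "sim s t \<Longrightarrow> sim u v \<Longrightarrow> sim (s \<cdot> u) (t \<cdot> v)"

lemma T_sym:
  assumes "Eq Z s t \<in> T" "wt [] s Z" "wt [] t Z" shows "Eq Z t s \<in> T"
  using T_subst[of Z s t "Eq Z (Bnd 0) s"] assms T_refl 
  by (simp add: inst_tm_closed wt_weaken)

lemma T_trans: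
  assumes "Eq Z s t \<in> T" "Eq Z t u \<in> T" "wt [] s Z" "wt [] t Z" "wt [] u Z" shows "Eq Z s u \<in> T"
  using T_subst[of Z t u "Eq Z s (Bnd 0)"] assms 
  by (simp add: inst_tm_closed wt_weaken)

lemma T_App:
  assumes "Eq (Y \<rightarrow> Z) s t \<in> T" "Eq Y u v \<in> T" 
    "wt [] s (Y \<rightarrow> Z)" "wt [] t (Y \<rightarrow> Z)" "wt [] u Y" "wt [] v Y"
  shows "Eq Z (s \<cdot> u) (t \<cdot> v) \<in> T"
proof -
  have "wff [Y \<rightarrow> Z] (Eq Z (s \<cdot> u) (Bnd 0 \<cdot> u))" "wff [Y] (Eq Z (s \<cdot> u) (t \<cdot> Bnd 0))"
    using assms by (auto simp: wt_weaken intro!: exI[of _ Y])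
  moreover have "Eq Z (s \<cdot> u) (s \<cdot> u) \<in> T" using assms by (intro T_refl) auto
  ultimately have "Eq Z (s \<cdot> u) (t \<cdot> u) \<in> T" "wff [Y] (Eq Z (s \<cdot> u) (t \<cdot> Bnd 0))"
    using T_subst[of "Y \<rightarrow> Z" s t "Eq Z (s \<cdot> u) (Bnd 0 \<cdot> u)"] assms
    by (auto simp: inst_tm_closed wt_weaken)
  then show ?thesis
    using T_subst[of Y u v "Eq Z (s \<cdot> u) (t \<cdot> Bnd 0)"] assms
    by (auto simp: inst_tm_closed wt_weaken)
qed

lemma sim_typed:
  "sim s t \<Longrightarrow> (wt [] s Z \<longleftrightarrow> wt [] t Z) \<and> (wt [] s Z \<longrightarrow> Eq Z s t \<in> T)"
proof (induction arbitrary: Z rule: sim.induct)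
  case (sim_Eq s Z t)
  then show ?case using wt_unique by blast
next
  case (sim_App s t u v)
  then show ?case using T_App by (metis wt.simps(4))
qed (use T_refl T_sym T_trans in blast)+

lemma sim_fill:
  assumes "sim s t" "wff [Z] A" "wt [] s Z"
  shows "A\<lbrakk>s\<rbrakk> \<in> T \<longleftrightarrow> A\<lbrakk>t\<rbrakk> \<in> T"
  using assms sim_typed T_subst sim_sym by blast

text \<open>A chosen representative of the equivalence class of a term. Values are representatives, so that
  provable equality becomes equality of values.\<close>

definition rep :: "tm \<Rightarrow> tm" where
  "rep t = (SOME s. sim s t)"

lemma sim_rep: "sim (rep t) t"
  unfolding rep_def by (rule someI[of _ t]) (rule sim_refl)

lemma rep_eq: "rep s = rep t \<longleftrightarrow> sim s t"
proof
  assume "rep s = rep t"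
  then show "sim s t" using sim_rep[of s] sim_rep[of t] sim_sym sim_trans by metis
next
  assume "sim s t"
  then have "sim u s = sim u t" for u using sim_sym sim_trans by blast
  then show "rep s = rep t" by (simp add: rep_def)
qed

lemma rep_rep [simp]: "rep (rep t) = rep t"
  by (simp add: rep_eq sim_rep)

lemma tp_rep [simp]: "tp (rep t) = tp t"
  using sim_typed[OF sim_rep] by (intro tp_eqI) blast

lemma rep_eq_Eq: "tp s = Some Z \<Longrightarrow> tp t = Some Z \<Longrightarrow> rep s = rep t \<longleftrightarrow> Eq Z s t \<in> T"
  unfolding rep_eq wt_tp[symmetric] using sim_typed sim_Eq by blast

text \<open>From here on the typing of equations is computed by the partial function above.\<close>

declare wff.simps(1) [simp del]

definition ap :: "tm \<Rightarrow> tm \<Rightarrow> tm"  (infixl "\<bullet>" 200) where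
  "f \<bullet> a = rep (f \<cdot> a)"

definition dom :: "ty \<Rightarrow> tm set" where
  "dom Z = {a. rep a = a \<and> tp a = Some Z}"

definition val :: "(string \<times> ty \<Rightarrow> tm) \<Rightarrow> tm \<Rightarrow> tm" where
  "val \<rho> t = rep (msub_tm \<rho> t)"

definition sat :: "(string \<times> ty \<Rightarrow> tm) \<Rightarrow> fm \<Rightarrow> bool" where
  "sat \<rho> A \<longleftrightarrow> msub_fm \<rho> A \<in> T"

lemma dom_iff: "a \<in> dom Z \<longleftrightarrow> rep a = a \<and> tp a = Some Z"
  by (simp add: dom_def)

lemma rep_ap [simp]: "rep (f \<bullet> a) = f \<bullet> a"
  by (simp add: ap_def)

lemma tp_ap [simp]: "tp (f \<bullet> a) = tp_app (tp f) (tp a)"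
  by (simp add: ap_def)

lemma rep_App [simp]: "rep (s \<cdot> t) = rep s \<bullet> rep t"
  by (simp add: ap_def rep_eq sim_App sim_rep sim_sym)

lemma dom_ap: "f \<in> dom (Y \<rightarrow> Z) \<Longrightarrow> a \<in> dom Y \<Longrightarrow> f \<bullet> a \<in> dom Z"
  by (simp add: dom_iff)

lemma rep_val [simp]: "rep (val \<rho> t) = val \<rho> t"
  by (simp add: val_def)

lemma tp_val [simp]: "wt_env \<rho> \<Longrightarrow> tp t \<noteq> None \<Longrightarrow> tp (val \<rho> t) = tp t"
  using wt_msub[of "[]" t] by (auto simp: val_def wt_tp)

lemma val_App [simp]: "val \<rho> (s \<cdot> t) = val \<rho> s \<bullet> val \<rho> t"
  by (simp add: val_def)

lemma val_Cst [simp]: "val \<rho> (Cst c) = rep (Cst c)"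
  by (simp add: val_def)

lemma val_Fre_same [simp]: "val (\<rho>((x, Z) := a)) (Fre x Z) = rep a"
  by (simp add: val_def)

lemma val_Fre_other [simp]: "(y, V) \<noteq> (x, Z) \<Longrightarrow> val (\<rho>((x, Z) := a)) (Fre y V) = val \<rho> (Fre y V)"
  by (auto simp: val_def)

lemma val_id: "val id_env t = rep t"
  by (simp add: val_def)

lemma sat_id: "sat id_env A \<longleftrightarrow> A \<in> T"
  by (simp add: sat_def)

lemma val_closed: "fv_tm t = {} \<Longrightarrow> val \<rho> t = rep t"
  using msub_tm_cong[of t \<rho> id_env] by (simp add: val_def)

lemma val_zero [simp]: "val \<rho> (zero Z) = rep (zero Z)"
  by (simp add: val_closed)

text \<open>An abstraction in the scope of a variable that it does not mention has the same value for all values of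
  that variable. The recursion laws need this for step functions inside a term
  that also binds the recursion argument.\<close>

lemma val_upd_idle: "(x, Y) \<notin> fv_tm t \<Longrightarrow> val (\<rho>((x, Y) := u)) t = val \<rho> t"
  unfolding val_def by (metis fun_upd_other msub_tm_cong)

lemma val_upd_lam [simp]:
  "(x, Y) \<notin> fv_tm (lam y Z f) \<Longrightarrow> val (\<rho>((x, Y) := u)) (lam y Z f) = val \<rho> (lam y Z f)"
  by (rule val_upd_idle)

lemma rep_lam: "rep (lam x Y f) = val id_env (lam x Y f)"
  by (simp add: val_id)

text \<open>The two forms of the conversion rule: for de Bruijn terms, and for named binders, where applying
  a value updates the environment.\<close>

lemma rep_beta: 
  assumes "wt [Y] b Z" "wt [] t Y" shows "rep (Lam Y b) \<bullet> rep t = rep (inst_tm 0 t b)"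
proof -
  have w: "wt [] (Lam Y b \<cdot> t) Z" "wt [] (inst_tm 0 t b) Z" using assms wt_inst[of "[]"] by auto
  then have "Eq Z (Lam Y b \<cdot> t) (inst_tm 0 t b) \<in> T"
    by (intro T_axiom ax_beta[OF assms]) (simp only: wff.simps)
  then have "rep (Lam Y b \<cdot> t) = rep (inst_tm 0 t b)"
    by (simp only: rep_eq_Eq[OF w[unfolded wt_tp]])
  then show ?thesis by simp
qed

lemma beta [simp]:
  assumes "wt_env \<rho>" "tp (f (Fre x Y)) \<noteq> None" "rep a = a" "tp a = Some Y"
  shows "val \<rho> (lam x Y f) \<bullet> a = val (\<rho>((x, Y) := a)) (f (Fre x Y))"
proof -
  let ?b = "msub_tm \<rho> (abs_tm 0 x Y (f (Fre x Y)))"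
  obtain Z where Z: "wt [] (f (Fre x Y)) Z" using assms by (auto simp: wt_tp)
  then have "wt [Y] ?b Z" using wt_abs[of "[]"] wt_msub assms by fastforce
  then have "val \<rho> (lam x Y f) \<bullet> rep a = rep (inst_tm 0 a ?b)"
    using rep_beta[of Y ?b Z a] assms by (simp add: val_def lam_def wt_tp)
  then show ?thesis
    using inst_msub_abs_tm[of "[]"] Z assms by (simp add: val_def)
qed

lemma sat_bot [simp]: "\<not> sat \<rho> \<^bold>\<bottom>"
  by (simp add: sat_def T_bot)

lemma sat_Imp [simp]:
  "wt_env \<rho> \<Longrightarrow> wff [] A \<Longrightarrow> wff [] B \<Longrightarrow> sat \<rho> (A \<^bold>\<longrightarrow> B) \<longleftrightarrow> (sat \<rho> A \<longrightarrow> sat \<rho> B)"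
  by (simp add: sat_def T_Imp wff_msub)

lemma sat_Neg [simp]: "wt_env \<rho> \<Longrightarrow> wff [] A \<Longrightarrow> sat \<rho> (\<^bold>\<not> A) \<longleftrightarrow> \<not> sat \<rho> A"
  by (simp add: Neg_def)

lemma sat_Conj [simp]:
  "wt_env \<rho> \<Longrightarrow> wff [] A \<Longrightarrow> wff [] B \<Longrightarrow> sat \<rho> (A \<^bold>\<and> B) \<longleftrightarrow> sat \<rho> A \<and> sat \<rho> B"
  by (simp add: Conj_def)

lemma sat_Disj [simp]:
  "wt_env \<rho> \<Longrightarrow> wff [] A \<Longrightarrow> wff [] B \<Longrightarrow> sat \<rho> (A \<^bold>\<or> B) \<longleftrightarrow> sat \<rho> A \<or> sat \<rho> B"
  by (auto simp add: Disj_def)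

lemma sat_Eq [simp]:
  "wt_env \<rho> \<Longrightarrow> tp s = Some Z \<Longrightarrow> tp t = Some Z \<Longrightarrow> sat \<rho> (Eq Z s t) \<longleftrightarrow> val \<rho> s = val \<rho> t"
  using wt_msub[of "[]" s Z \<rho>] wt_msub[of "[]" t Z \<rho>] 
  by (simp add: sat_def val_def rep_eq_Eq wt_tp)

lemma sat_Tr [simp]: "wt_env \<rho> \<Longrightarrow> tp b = Some TB \<Longrightarrow> sat \<rho> (Tr b) \<longleftrightarrow> val \<rho> b = rep tt"
  by (simp add: Tr_def)

lemma fill_rep: "wff [Z] A \<Longrightarrow> tp t = Some Z \<Longrightarrow> A\<lbrakk>rep t\<rbrakk> \<in> T \<longleftrightarrow> A\<lbrakk>t\<rbrakk> \<in> T"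
  by (simp add: sim_fill sim_rep wt_tp)

lemma T_All_dom:
  assumes "wff [Z] A"
  shows "All Z A \<in> T \<longleftrightarrow> (\<forall>a\<in>dom Z. A\<lbrakk>a\<rbrakk> \<in> T)"
proof -
  have "A\<lbrakk>t\<rbrakk> \<in> T" if "\<forall>a\<in>dom Z. A\<lbrakk>a\<rbrakk> \<in> T" "tp t = Some Z" for t
    using that fill_rep[OF assms, of t] by (simp add: dom_iff)
  then show ?thesis using assms by (auto simp: T_All dom_iff wt_tp)
qed

lemma sat_all [simp]:
  assumes "wt_env \<rho>" "wff [] (F (Fre x Z))"
  shows "sat \<rho> (all x Z F) \<longleftrightarrow> (\<forall>a\<in>dom Z. sat (\<rho>((x, Z) := a)) (F (Fre x Z)))"
proof -
  have "wff [Z] (msub_fm \<rho> (abs_fm 0 x Z (F (Fre x Z))))"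
    using assms wff_abs[of "[]"] wff_msub by fastforce
  then show ?thesis
    using assms by (simp add: sat_def all_def T_All_dom inst_msub_abs_fm[of "[]"])
qed

lemma sat_ex [simp]:
  assumes "wt_env \<rho>" "wff [] (F (Fre x Z))"
  shows "sat \<rho> (ex x Z F) \<longleftrightarrow> (\<exists>a\<in>dom Z. sat (\<rho>((x, Z) := a)) (F (Fre x Z)))"
  using assms by (simp add: ex_def dom_iff)

lemma sat_upd_idle: "(x, Y) \<notin> fv_fm A \<Longrightarrow> sat (\<rho>((x, Y) := u)) A = sat \<rho> A"
  unfolding sat_def by (metis fun_upd_other msub_fm_cong)

lemma sat_axiom: "A \<in> axs X lt \<Longrightarrow> wff [] A \<Longrightarrow> sat id_env A"
  by (simp add: sat_id T_axiom)

lemma ap_eqI: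
  assumes f: "f \<in> dom (Y \<rightarrow> Z)" and g: "g \<in> dom (Y \<rightarrow> Z)"
    and eq: "\<And>a. a \<in> dom Y \<Longrightarrow> f \<bullet> a = g \<bullet> a"
  shows "f = g"
proof -
  obtain x where "\<forall>V. (x, V) \<notin> fv_tm f \<union> fv_tm g"
    using fresh_name[of "fv_tm f \<union> fv_tm g"] by (auto simp: finite_fv_tm)
  then have x: "(x, Y) \<notin> fv_tm f" "(x, Y) \<notin> fv_tm g" by auto
  have "sat id_env (all x Y (\<lambda>x. Eq Z (f \<cdot> x) (g \<cdot> x)) \<^bold>\<longrightarrow> Eq (Y \<rightarrow> Z) f g)"
    using f g x by (intro sat_axiom ax_extensionality) (simp_all add: dom_iff wt_tp)
  moreover have "sat id_env (all x Y (\<lambda>x. Eq Z (f \<cdot> x) (g \<cdot> x)))"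
    using f g x eq by (simp add: dom_iff val_upd_idle val_id)
  ultimately show ?thesis
    using f g by (simp add: dom_iff val_id)
qed

text \<open>Induction in the model is available for the predicates \<open>Q\<close> defined by a formula \<open>B\<close> whose
  parameters are supplied by the environment. The instances below name the formula explicitly.\<close>

lemma nat_induction:
  assumes \<rho>: "wt_env \<rho>" and B: "wff [] B"
    and Q: "\<And>a. a \<in> dom TN \<Longrightarrow> Q a \<longleftrightarrow> sat (\<rho>((x, TN) := a)) B"
    and Ze: "Q (rep Ze)" and Su: "\<And>a. a \<in> dom TN \<Longrightarrow> Q a \<Longrightarrow> Q (rep Su \<bullet> a)"
    and a: "a \<in> dom TN"
  shows "Q a"
proof -
  define A where "A = msub_fm \<rho> (abs_fm 0 x TN B)"
  have wA: "wff [TN] A" unfolding A_def using \<rho> B wff_abs[of "[]"] wff_msub by fastforce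
  have A: "A\<lbrakk>u\<rbrakk> \<in> T \<longleftrightarrow> Q u" if "u \<in> dom TN" for u
    using that Q[of u] \<rho> B by (simp add: A_def sat_def inst_msub_abs_fm[of "[]"])
  obtain n where n: "\<forall>V. (n, V) \<notin> fv_fm A"
    using fresh_name[of "fv_fm A"] by (auto simp: finite_fv_fm)
  then have id: "msub_fm (id_env((n, TN) := u)) A = A" for u
    by (metis fun_upd_other msub_fm_cong msub_id_fm n)
  have "(A\<lbrakk>Ze\<rbrakk> \<^bold>\<longrightarrow> all n TN (\<lambda>n. A\<lbrakk>n\<rbrakk> \<^bold>\<longrightarrow> A\<lbrakk>Su \<cdot> n\<rbrakk>) \<^bold>\<longrightarrow> All TN A) \<in> axs X lt" 
    using wA n by (intro ax_nat_induction) auto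
  moreover have w: "wff [] (A\<lbrakk>Ze\<rbrakk>)" "wff [] (A\<lbrakk>Fre n TN\<rbrakk>)" "wff [] (A\<lbrakk>Su \<cdot> Fre n TN\<rbrakk>)"
    using wA by (simp_all add: wff_fill wt_tp)
  ultimately have "sat id_env (A\<lbrakk>Ze\<rbrakk> \<^bold>\<longrightarrow> all n TN (\<lambda>n. A\<lbrakk>n\<rbrakk> \<^bold>\<longrightarrow> A\<lbrakk>Su \<cdot> n\<rbrakk>) \<^bold>\<longrightarrow> All TN A)"
    using wA by (intro sat_axiom) auto
  moreover have "sat id_env (A\<lbrakk>Ze\<rbrakk>)" 
    using A[of "rep Ze"] wA Ze by (simp add: dom_iff fill_rep sat_id)
  moreover have n_sat: "sat (id_env((n, TN) := u)) (A\<lbrakk>Fre n TN\<rbrakk>) \<longleftrightarrow> A\<lbrakk>u\<rbrakk> \<in> T"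
    "sat (id_env((n, TN) := u)) (A\<lbrakk>Su \<cdot> Fre n TN\<rbrakk>) \<longleftrightarrow> A\<lbrakk>Su \<cdot> u\<rbrakk> \<in> T" if "u \<in> dom TN" for u
    using that by (simp_all add: sat_def msub_inst_fm id dom_iff)
  have "A\<lbrakk>Su \<cdot> u\<rbrakk> \<in> T \<longleftrightarrow> Q (rep Su \<bullet> u)" if "u \<in> dom TN" for u
    using A[of "rep Su \<bullet> u"] fill_rep[OF wA, of "Su \<cdot> u"] that by (simp add: dom_iff)
  then have "sat id_env (all n TN (\<lambda>n. A\<lbrakk>n\<rbrakk> \<^bold>\<longrightarrow> A\<lbrakk>Su \<cdot> n\<rbrakk>))"
    using w A Su by (simp add: dom_iff n_sat)
  ultimately have "All TN A \<in> T"
    using w wA by (simp add: sat_id T_Imp)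
  then show ?thesis using A a wA by (simp add: T_All_dom)
qed

lemma cond_tt [simp]: 
  assumes "rep a = a" "rep b = b" "tp a = Some Z" "tp b = Some Z" 
  shows "rep (Cond Z) \<bullet> rep tt \<bullet> a \<bullet> b = a"
  using sat_axiom[OF ax_cond_tt[of a Z b]] assms by (simp add: wt_tp val_id)

lemma cond_ff [simp]: 
  assumes "rep a = a" "rep b = b" "tp a = Some Z" "tp b = Some Z" 
  shows "rep (Cond Z) \<bullet> rep ff \<bullet> a \<bullet> b = b"
  using sat_axiom[OF ax_cond_ff[of a Z b]] assms by (simp add: wt_tp val_id)

lemma tt_neq_ff [simp]: "rep tt \<noteq> rep ff" "rep ff \<noteq> rep tt"
  using sat_axiom[OF ax_tt_ff] by (simp_all add: wt_tp val_id)

lemma bool_cases: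
  assumes "rep b = b" "tp b = Some TB" shows "b = rep tt \<or> b = rep ff"
  using sat_axiom[OF ax_bool_cases[of b]] assms by (simp add: wt_tp val_id)

lemma fst_pair [simp]:
  assumes "rep a = a" "rep b = b" "tp a = Some Y" "tp b = Some Z" 
  shows "rep (Pfst Y Z) \<bullet> (rep (Pr Y Z) \<bullet> a \<bullet> b) = a"
  using sat_axiom[OF ax_fst_pair[of a Y b Z]] assms by (simp add: wt_tp val_id)

lemma snd_pair [simp]:
  assumes "rep a = a" "rep b = b" "tp a = Some Y" "tp b = Some Z" 
  shows "rep (Psnd Y Z) \<bullet> (rep (Pr Y Z) \<bullet> a \<bullet> b) = b"
  using sat_axiom[OF ax_snd_pair[of a Y b Z]] assms by (simp add: wt_tp val_id)

lemma suc_neq_zero [simp]: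
  assumes "rep n = n" "tp n = Some TN" shows "rep Su \<bullet> n \<noteq> rep Ze"
  using sat_axiom[OF ax_suc_zero[of n]] assms by (simp add: wt_tp val_id)

lemma suc_inj [simp]:
  assumes "rep n = n" "tp n = Some TN" "rep m = m" "tp m = Some TN"
  shows "rep Su \<bullet> m = rep Su \<bullet> n \<longleftrightarrow> m = n"
  using sat_axiom[OF ax_suc_inj[of m n]] assms by (auto simp add: wt_tp val_id)

lemma rec_zero [simp]:
  assumes "rep a = a" "rep f = f" "tp a = Some Z" "tp f = Some (TN \<rightarrow> Z \<rightarrow> Z)" 
  shows "rep (Rec Z) \<bullet> a \<bullet> f \<bullet> rep Ze = a"
  using sat_axiom[OF ax_rec_zero[of a Z f]] assms by (simp add: wt_tp val_id)

lemma rec_suc [simp]: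
  assumes "rep a = a" "rep f = f" "rep n = n" 
    "tp a = Some Z" "tp f = Some (TN \<rightarrow> Z \<rightarrow> Z)" "tp n = Some TN" 
  shows "rep (Rec Z) \<bullet> a \<bullet> f \<bullet> (rep Su \<bullet> n) = f \<bullet> n \<bullet> (rep (Rec Z) \<bullet> a \<bullet> f \<bullet> n)"
  using sat_axiom[OF ax_rec_suc[of a Z f n]] assms by (simp add: wt_tp val_id)

end


section \<open>Arithmetic and sequence operations in the model\<close>

lemma tp_predt [simp]: "tp predt = Some (TN \<rightarrow> TN)"
  and fv_predt [simp]: "fv_tm predt = {}"
  by (simp_all add: predt_def)

lemma tp_subt [simp]: "tp subt = Some (TN \<rightarrow> TN \<rightarrow> TN)"
  and fv_subt [simp]: "fv_tm subt = {}"
  by (auto simp add: subt_def)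

lemma tp_post [simp]: "tp post = Some (TN \<rightarrow> TB)"
  and fv_post [simp]: "fv_tm post = {}"
  by (simp_all add: post_def)

lemma tp_lesst [simp]: "tp lesst = Some (TN \<rightarrow> TN \<rightarrow> TB)"
  and fv_lesst [simp]: "fv_tm lesst = {}"
  by (auto simp add: lesst_def)

lemma tp_bext [simp]: "tp bext = Some ((TN \<rightarrow> TB) \<rightarrow> TN \<rightarrow> TB)"
  and fv_bext [simp]: "fv_tm bext = {}"
  by (auto simp add: bext_def)

lemma tp_init [simp]: "tp (init Z) = Some (Sq Z \<rightarrow> TN \<rightarrow> TSeq Z)"
  and fv_init [simp]: "fv_tm (init Z) = {}"
  by (auto simp add: init_def)

lemma tp_push [simp]: "tp (push Z) = Some (Z \<rightarrow> Sq Z \<rightarrow> Sq Z)"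
  and fv_push [simp]: "fv_tm (push Z) = {}"
  by (auto simp add: push_def)

lemma tp_cat [simp]: "tp (cat Z) = Some (TSeq Z \<rightarrow> Sq Z \<rightarrow> Sq Z)"
  and fv_cat [simp]: "fv_tm (cat Z) = {}"
  by (auto simp add: cat_def)

lemma tp_ext [simp]: "tp (ext Z) = Some (Sq Z \<rightarrow> TN \<rightarrow> Sq Z)"
  and fv_ext [simp]: "fv_tm (ext Z) = {}"
  by (auto simp add: ext_def ifz_def)

lemma tp_spec [simp]: "tp (spec Z) = Some (Sq Z \<rightarrow> (Sq Z \<rightarrow> TN) \<rightarrow> Sq Z)"
  and fv_spec [simp]: "fv_tm (spec Z) = {}"
  by (auto simp add: spec_def)

lemma tp_eqNt [simp]: "tp eqNt = Some (TN \<rightarrow> TN \<rightarrow> TB)"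
  and fv_eqNt [simp]: "fv_tm eqNt = {}"
  by (auto simp add: eqNt_def)

lemma tp_eqBt [simp]: "tp eqBt = Some (TB \<rightarrow> TB \<rightarrow> TB)"
  and fv_eqBt [simp]: "fv_tm eqBt = {}"
  by (auto simp add: eqBt_def)

lemma tp_chi [simp]: "qf A \<Longrightarrow> wff [] A \<Longrightarrow> tp (chi A) = Some TB"
  by (induction A) (auto simp: wt_tp)

context henkin_theory
begin

declare dom_iff [simp]

lemma val_constants [simp]:
  "val \<rho> predt = rep predt" "val \<rho> subt = rep subt" "val \<rho> post = rep post"
  "val \<rho> lesst = rep lesst" "val \<rho> bext = rep bext" "val \<rho> (init Z) = rep (init Z)"
  "val \<rho> (push Z) = rep (push Z)" "val \<rho> (cat Z) = rep (cat Z)" "val \<rho> (ext Z) = rep (ext Z)"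
  "val \<rho> (spec Z) = rep (spec Z)" "val \<rho> eqNt = rep eqNt" "val \<rho> eqBt = rep eqBt"
  by (simp_all add: val_closed)

abbreviation less :: "tm \<Rightarrow> tm \<Rightarrow> bool" where
  "less m n \<equiv> rep lesst \<bullet> m \<bullet> n = rep tt"

lemma pred_eqs [simp]:
  "rep predt \<bullet> rep Ze = rep Ze"
  "n \<in> dom TN \<Longrightarrow> rep predt \<bullet> (rep Su \<bullet> n) = n"
  by (simp_all add: predt_def rep_lam)

lemma sub_eqs [simp]:
  "m \<in> dom TN \<Longrightarrow> rep subt \<bullet> m \<bullet> rep Ze = m"
  "m \<in> dom TN \<Longrightarrow> n \<in> dom TN \<Longrightarrow> 
    rep subt \<bullet> m \<bullet> (rep Su \<bullet> n) = rep predt \<bullet> (rep subt \<bullet> m \<bullet> n)"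
  by (simp_all add: subt_def rep_lam)

lemma pos_eqs [simp]:
  "rep post \<bullet> rep Ze = rep ff"
  "n \<in> dom TN \<Longrightarrow> rep post \<bullet> (rep Su \<bullet> n) = rep tt"
  by (simp_all add: post_def rep_lam)

lemma less_eq: "m \<in> dom TN \<Longrightarrow> n \<in> dom TN \<Longrightarrow> rep lesst \<bullet> m \<bullet> n = rep post \<bullet> (rep subt \<bullet> n \<bullet> m)"
  by (simp add: lesst_def rep_lam)

lemma sub_zero_left:
  assumes "n \<in> dom TN" shows "rep subt \<bullet> rep Ze \<bullet> n = rep Ze"
  by (rule nat_induction[where Q = "\<lambda>n. rep subt \<bullet> rep Ze \<bullet> n = rep Ze" and \<rho> = id_env and x = "''n''"
        and B = "Eq TN (subt \<cdot> Ze \<cdot> Fre ''n'' TN) Ze", OF _ _ _ _ _ assms]) simp_all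

lemma sub_suc_suc:
  assumes "m \<in> dom TN" "n \<in> dom TN" 
  shows "rep subt \<bullet> (rep Su \<bullet> m) \<bullet> (rep Su \<bullet> n) = rep subt \<bullet> m \<bullet> n"
  by (rule nat_induction[where
        Q = "\<lambda>n. rep subt \<bullet> (rep Su \<bullet> m) \<bullet> (rep Su \<bullet> n) = rep subt \<bullet> m \<bullet> n"
        and \<rho> = "id_env((''m'', TN) := m)" and x = "''n''"
        and B = "Eq TN (subt \<cdot> (Su \<cdot> Fre ''m'' TN) \<cdot> (Su \<cdot> Fre ''n'' TN)) (subt \<cdot> Fre ''m'' TN \<cdot> Fre ''n'' TN)",
        OF _ _ _ _ _ assms(2)]) (use assms in simp_all)

lemma less_eqs [simp]:
  "m \<in> dom TN \<Longrightarrow> rep lesst \<bullet> m \<bullet> rep Ze = rep ff"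
  "n \<in> dom TN \<Longrightarrow> rep lesst \<bullet> rep Ze \<bullet> (rep Su \<bullet> n) = rep tt"
  "m \<in> dom TN \<Longrightarrow> n \<in> dom TN \<Longrightarrow> rep lesst \<bullet> (rep Su \<bullet> m) \<bullet> (rep Su \<bullet> n) = rep lesst \<bullet> m \<bullet> n"
  by (simp_all add: less_eq sub_zero_left sub_suc_suc del: sub_eqs(2)) 

lemma nat_cases:
  assumes "n \<in> dom TN"
  obtains "n = rep Ze" | m where "m \<in> dom TN" "n = rep Su \<bullet> m"
proof -
  have "n = rep Ze \<or> (\<exists>m\<in>dom TN. n = rep Su \<bullet> m)"
    by (rule nat_induction[where Q = "\<lambda>n. n = rep Ze \<or> (\<exists>m\<in>dom TN. n = rep Su \<bullet> m)"
          and \<rho> = id_env and x = "''n''"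
          and B = "Eq TN (Fre ''n'' TN) Ze \<^bold>\<or> ex ''m'' TN (\<lambda>m. Eq TN (Fre ''n'' TN) (Su \<cdot> m))",
          OF _ _ _ _ _ assms]) auto
  then show ?thesis using that by blast
qed

text \<open>Induction on \<open>n\<close> for all \<open>m\<close>, since the step replaces \<open>m\<close> by its predecessor.\<close>

lemma less_suc:
  assumes "m \<in> dom TN" "n \<in> dom TN"
  shows "less m (rep Su \<bullet> n) \<longleftrightarrow> less m n \<or> m = n"
proof -
  let ?n = "Fre ''n'' TN"
  have "\<forall>m\<in>dom TN. less m (rep Su \<bullet> n) \<longleftrightarrow> less m n \<or> m = n"
  proof (rule nat_induction[where
        Q = "\<lambda>n. \<forall>m\<in>dom TN. less m (rep Su \<bullet> n) \<longleftrightarrow> less m n \<or> m = n" and \<rho> = id_env and x = "''n''" and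
        B = "all ''m'' TN (\<lambda>m. (Tr (lesst \<cdot> m \<cdot> (Su \<cdot> ?n)) \<^bold>\<longrightarrow> Tr (lesst \<cdot> m \<cdot> ?n) \<^bold>\<or> Eq TN m ?n) \<^bold>\<and>
          (Tr (lesst \<cdot> m \<cdot> ?n) \<^bold>\<or> Eq TN m ?n \<^bold>\<longrightarrow> Tr (lesst \<cdot> m \<cdot> (Su \<cdot> ?n))))",
        OF _ _ _ _ _ assms(2)])
    show "\<forall>m\<in>dom TN. less m (rep Su \<bullet> rep Ze) \<longleftrightarrow> less m (rep Ze) \<or> m = rep Ze"
    proof
      fix m assume m: "m \<in> dom TN"
      then show "less m (rep Su \<bullet> rep Ze) \<longleftrightarrow> less m (rep Ze) \<or> m = rep Ze"
        by (rule nat_cases) simp_all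
    qed
  next
    fix n
    assume n: "n \<in> dom TN" and IH: "\<forall>m\<in>dom TN. less m (rep Su \<bullet> n) \<longleftrightarrow> less m n \<or> m = n"
    show "\<forall>m\<in>dom TN. less m (rep Su \<bullet> (rep Su \<bullet> n)) \<longleftrightarrow> less m (rep Su \<bullet> n) \<or> m = rep Su \<bullet> n"
    proof
      fix m assume m: "m \<in> dom TN"
      then show "less m (rep Su \<bullet> (rep Su \<bullet> n)) \<longleftrightarrow> less m (rep Su \<bullet> n) \<or> m = rep Su \<bullet> n"
        by (rule nat_cases) (use n IH in simp_all)
    qed
  qed auto
  then show ?thesis using assms by blast
qed

lemma less_irrefl:
  assumes "n \<in> dom TN" shows "\<not> less n n"
  by (rule nat_induction[where Q = "\<lambda>n. \<not> less n n" and \<rho> = id_env and x = "''n''"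
        and B = "\<^bold>\<not> Tr (lesst \<cdot> Fre ''n'' TN \<cdot> Fre ''n'' TN)", OF _ _ _ _ _ assms]) simp_all

lemma less_trans:
  assumes "a \<in> dom TN" "b \<in> dom TN" "c \<in> dom TN" "less a b" "less b c"
  shows "less a c"
proof -
  have "less b c \<longrightarrow> less a c"
    by (rule nat_induction[where Q = "\<lambda>c. less b c \<longrightarrow> less a c" 
        and \<rho> = "id_env((''a'', TN) := a, (''b'', TN) := b)" and x = "''c''"
        and B = "Tr (lesst \<cdot> Fre ''b'' TN \<cdot> Fre ''c'' TN) \<^bold>\<longrightarrow> Tr (lesst \<cdot> Fre ''a'' TN \<cdot> Fre ''c'' TN)",
        OF _ _ _ _ _ assms(3)]) (use assms in \<open>auto simp: less_suc\<close>)
  then show ?thesis using assms by blast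
qed

lemma less_linear:
  assumes "m \<in> dom TN" "n \<in> dom TN"
  shows "less m n \<or> m = n \<or> less n m"
proof (rule nat_induction[where Q = "\<lambda>n. less m n \<or> m = n \<or> less n m" 
        and \<rho> = "id_env((''m'', TN) := m)" and x = "''n''"
        and B = "Tr (lesst \<cdot> Fre ''m'' TN \<cdot> Fre ''n'' TN) \<^bold>\<or> Eq TN (Fre ''m'' TN) (Fre ''n'' TN) \<^bold>\<or> 
          Tr (lesst \<cdot> Fre ''n'' TN \<cdot> Fre ''m'' TN)",
        OF _ _ _ _ _ assms(2)])
  show "less m (rep Ze) \<or> m = rep Ze \<or> less (rep Ze) m"
    using assms(1) by (rule nat_cases) simp_all
next
  fix n assume n: "n \<in> dom TN" and IH: "less m n \<or> m = n \<or> less n m"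
  have "m = rep Su \<bullet> n \<or> less (rep Su \<bullet> n) m" if "less n m"
    using assms(1) by (rule nat_cases) (use n that in \<open>auto simp: less_suc\<close>)
  then show "less m (rep Su \<bullet> n) \<or> m = rep Su \<bullet> n \<or> less (rep Su \<bullet> n) m"
    using IH n assms by (auto simp: less_suc)
qed (use assms in simp_all)

lemma not_less:
  assumes "m \<in> dom TN" "n \<in> dom TN"
  shows "\<not> less m n \<longleftrightarrow> less n (rep Su \<bullet> m)"
  using less_linear[OF assms] less_irrefl[of m] less_trans[of m n m] assms
  by (auto simp: less_suc)

text \<open>If there were no least number with \<open>Q\<close>, then by induction on a bound no number below it would
  have \<open>Q\<close>.\<close>

lemma least_number:
  assumes \<rho>: "wt_env \<rho>" and B: "wff [] B"
    and Q: "\<And>a. a \<in> dom TN \<Longrightarrow> Q a \<longleftrightarrow> sat (\<rho>((x, TN) := a)) B"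
    and n: "n \<in> dom TN" "Q n"
  shows "\<exists>m\<in>dom TN. Q m \<and> (\<forall>j\<in>dom TN. less j m \<longrightarrow> \<not> Q j)"
proof (rule ccontr)
  assume no_least: "\<not> ?thesis"
  obtain y where y: "\<forall>V. (y, V) \<notin> fv_fm B \<union> {(x, TN)}"
    using fresh_name[of "fv_fm B \<union> {(x, TN)}"] by (auto simp: finite_fv_fm)
  then have "y \<noteq> x" "(y, TN) \<notin> fv_fm B" by auto
  note y = this
  \<comment> \<open>The bound is named apart from the variables of \<open>B\<close>, so that its value does not matter there.\<close>
  have B_y: "sat (\<rho>((y, TN) := a, (x, TN) := j)) B \<longleftrightarrow> Q j" if "j \<in> dom TN" for a j
  proof -
    have "\<rho>((y, TN) := a, (x, TN) := j) = \<rho>((x, TN) := j, (y, TN) := a)"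
      using y by (intro fun_upd_twist) auto
    then show ?thesis using y Q[OF that] by (simp add: sat_upd_idle)
  qed
  have "\<forall>j\<in>dom TN. less j (rep Su \<bullet> n) \<longrightarrow> \<not> Q j"
  proof (rule nat_induction[where Q = "\<lambda>n. \<forall>j\<in>dom TN. less j n \<longrightarrow> \<not> Q j" and \<rho> = \<rho> and x = y
        and B = "all x TN (\<lambda>j. Tr (lesst \<cdot> j \<cdot> Fre y TN) \<^bold>\<longrightarrow> \<^bold>\<not> B)"])
    fix a assume a: "a \<in> dom TN"
    show "(\<forall>j\<in>dom TN. less j a \<longrightarrow> \<not> Q j) \<longleftrightarrow>
        sat (\<rho>((y, TN) := a)) (all x TN (\<lambda>j. Tr (lesst \<cdot> j \<cdot> Fre y TN) \<^bold>\<longrightarrow> \<^bold>\<not> B))"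
      using \<rho> B a y by (simp add: B_y)
  next
    fix a assume "a \<in> dom TN" "\<forall>j\<in>dom TN. less j a \<longrightarrow> \<not> Q j"
    then show "\<forall>j\<in>dom TN. less j (rep Su \<bullet> a) \<longrightarrow> \<not> Q j"
      using no_least by (auto simp: less_suc)
  qed (use \<rho> B n in simp_all)
  then show False using n by (auto simp: less_suc)
qed

text \<open>By induction, no number is a value of \<open>h\<close>. The descent is a function of the model, hence
  the predicate is definable.\<close>

lemma no_infinite_descent:
  assumes "h \<in> dom (TN \<rightarrow> TN)" 
    and "\<And>j. j \<in> dom TN \<Longrightarrow> h \<bullet> j = rep Su \<bullet> (h \<bullet> (rep Su \<bullet> j))"
  shows False
proof -
  have "\<forall>j\<in>dom TN. h \<bullet> j \<noteq> n" if "n \<in> dom TN" for n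
  proof (rule nat_induction[where Q = "\<lambda>n. \<forall>j\<in>dom TN. h \<bullet> j \<noteq> n" and x = "''n''"
        and \<rho> = "id_env((''h'', TN \<rightarrow> TN) := h)"
        and B = "all ''j'' TN (\<lambda>j. \<^bold>\<not> Eq TN (Fre ''h'' (TN \<rightarrow> TN) \<cdot> j) (Fre ''n'' TN))", OF _ _ _ _ _ that])
    show "\<forall>j\<in>dom TN. h \<bullet> j \<noteq> rep Ze" using assms by (metis dom_ap dom_iff suc_neq_zero rep_ap rep_rep tp_rep tp_Cst cst_ty.simps)
  next
    fix n assume n: "n \<in> dom TN" and IH: "\<forall>j\<in>dom TN. h \<bullet> j \<noteq> n"
    show "\<forall>j\<in>dom TN. h \<bullet> j \<noteq> rep Su \<bullet> n"
    proof
      fix j assume j: "j \<in> dom TN"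
      then have "h \<bullet> (rep Su \<bullet> j) \<noteq> n" using IH by simp
      then show "h \<bullet> j \<noteq> rep Su \<bullet> n" using assms(1) assms(2)[OF j] j n by simp
    qed
  qed (use assms(1) in simp_all)
  from this[of "h \<bullet> rep Ze"] have "\<forall>j\<in>dom TN. h \<bullet> j \<noteq> h \<bullet> rep Ze" using assms(1) by simp
  moreover have "rep Ze \<in> dom TN" by simp
  ultimately show False by blast
qed

lemma init_eqs [simp]:
  "u \<in> dom (Sq Z) \<Longrightarrow> rep (init Z) \<bullet> u \<bullet> rep Ze = rep (Nl Z)"
  "u \<in> dom (Sq Z) \<Longrightarrow> n \<in> dom TN \<Longrightarrow>
    rep (init Z) \<bullet> u \<bullet> (rep Su \<bullet> n) = rep (Snoc Z) \<bullet> (rep (init Z) \<bullet> u \<bullet> n) \<bullet> (u \<bullet> n)"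
  by (simp_all add: init_def rep_lam)

text \<open>Recursive calls at \<open>[u](n) * w\<close> depend on \<open>u\<close> only through the initial segment, so comparing
  initial segments is enough to compare the calls, whatever concatenation does.\<close>

lemma init_cong:
  assumes "u \<in> dom (Sq Z)" "v \<in> dom (Sq Z)" "n \<in> dom TN"
    and "\<And>i. i \<in> dom TN \<Longrightarrow> less i n \<Longrightarrow> u \<bullet> i = v \<bullet> i"
  shows "rep (init Z) \<bullet> u \<bullet> n = rep (init Z) \<bullet> v \<bullet> n"
proof -
  let ?u = "Fre ''u'' (Sq Z)" and ?v = "Fre ''v'' (Sq Z)" and ?n = "Fre ''n'' TN"
  have "(\<forall>i\<in>dom TN. less i n \<longrightarrow> u \<bullet> i = v \<bullet> i) \<longrightarrow> rep (init Z) \<bullet> u \<bullet> n = rep (init Z) \<bullet> v \<bullet> n"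
    by (rule nat_induction[where x = "''n''" and \<rho> = "id_env((''u'', Sq Z) := u, (''v'', Sq Z) := v)" and
        Q = "\<lambda>n. (\<forall>i\<in>dom TN. less i n \<longrightarrow> u \<bullet> i = v \<bullet> i) \<longrightarrow>
          rep (init Z) \<bullet> u \<bullet> n = rep (init Z) \<bullet> v \<bullet> n" and
        B = "all ''i'' TN (\<lambda>i. Tr (lesst \<cdot> i \<cdot> ?n) \<^bold>\<longrightarrow> Eq Z (?u \<cdot> i) (?v \<cdot> i)) \<^bold>\<longrightarrow>
          Eq (TSeq Z) (init Z \<cdot> ?u \<cdot> ?n) (init Z \<cdot> ?v \<cdot> ?n)", OF _ _ _ _ _ assms(3)])
      (use assms(1,2) in \<open>simp_all add: less_suc\<close>)
  then show ?thesis using assms(4) by blast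
qed

lemma ifz_eq:
  assumes "b \<in> dom TB" "e \<in> dom Z"
  shows "rep (Cond Z) \<bullet> b \<bullet> e \<bullet> rep (zero Z) = (if b = rep tt then e else rep (zero Z))"
  using bool_cases[of b] assms by auto

lemma ext_eq [simp]:
  assumes "a \<in> dom (Sq Z)" "m \<in> dom TN" "n \<in> dom TN"
  shows "rep (ext Z) \<bullet> a \<bullet> m \<bullet> n = (if less n m then a \<bullet> n else rep (zero Z))"
  using assms by (simp add: ext_def ifz_def rep_lam ifz_eq)

lemma bext_eqs:
  "f \<in> dom (TN \<rightarrow> TB) \<Longrightarrow> rep bext \<bullet> f \<bullet> rep Ze = f \<bullet> rep Ze"
  "f \<in> dom (TN \<rightarrow> TB) \<Longrightarrow> n \<in> dom TN \<Longrightarrow> rep bext \<bullet> f \<bullet> (rep Su \<bullet> n) =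
    rep (Cond TB) \<bullet> (rep bext \<bullet> f \<bullet> n) \<bullet> rep tt \<bullet> (f \<bullet> (rep Su \<bullet> n))"
  by (simp_all add: bext_def rep_lam)

text \<open>The bound \<open>m \<le> n\<close> is expressed as \<open>m < n + 1\<close>.\<close>

lemma bext_iff:
  assumes f: "f \<in> dom (TN \<rightarrow> TB)" and n: "n \<in> dom TN"
  shows "rep bext \<bullet> f \<bullet> n = rep tt \<longleftrightarrow> (\<exists>m\<in>dom TN. less m (rep Su \<bullet> n) \<and> f \<bullet> m = rep tt)"
proof (rule nat_induction[where x = "''n''" and \<rho> = "id_env((''f'', TN \<rightarrow> TB) := f)" and
      Q = "\<lambda>n. rep bext \<bullet> f \<bullet> n = rep tt \<longleftrightarrow> (\<exists>m\<in>dom TN. less m (rep Su \<bullet> n) \<and> f \<bullet> m = rep tt)" and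
      B = "(Tr (bext \<cdot> Fre ''f'' (TN \<rightarrow> TB) \<cdot> Fre ''n'' TN) \<^bold>\<longrightarrow> 
          ex ''m'' TN (\<lambda>m. Tr (lesst \<cdot> m \<cdot> (Su \<cdot> Fre ''n'' TN)) \<^bold>\<and> Tr (Fre ''f'' (TN \<rightarrow> TB) \<cdot> m))) \<^bold>\<and>
        (ex ''m'' TN (\<lambda>m. Tr (lesst \<cdot> m \<cdot> (Su \<cdot> Fre ''n'' TN)) \<^bold>\<and> Tr (Fre ''f'' (TN \<rightarrow> TB) \<cdot> m)) \<^bold>\<longrightarrow>
          Tr (bext \<cdot> Fre ''f'' (TN \<rightarrow> TB) \<cdot> Fre ''n'' TN))", OF _ _ _ _ _ n])
  show "rep bext \<bullet> f \<bullet> rep Ze = rep tt \<longleftrightarrow> 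
      (\<exists>m\<in>dom TN. less m (rep Su \<bullet> rep Ze) \<and> f \<bullet> m = rep tt)"
    using f by (auto simp: bext_eqs less_suc)
next
  fix n
  assume n: "n \<in> dom TN" and
    IH: "rep bext \<bullet> f \<bullet> n = rep tt \<longleftrightarrow> (\<exists>m\<in>dom TN. less m (rep Su \<bullet> n) \<and> f \<bullet> m = rep tt)"
  have "rep bext \<bullet> f \<bullet> (rep Su \<bullet> n) = rep tt \<longleftrightarrow> rep bext \<bullet> f \<bullet> n = rep tt \<or> f \<bullet> (rep Su \<bullet> n) = rep tt"
    using bool_cases[of "rep bext \<bullet> f \<bullet> n"] f n by (auto simp: bext_eqs)
  then show "rep bext \<bullet> f \<bullet> (rep Su \<bullet> n) = rep tt \<longleftrightarrow> 
      (\<exists>m\<in>dom TN. less m (rep Su \<bullet> (rep Su \<bullet> n)) \<and> f \<bullet> m = rep tt)"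
    unfolding IH using f n by (auto simp: less_suc)
qed (use f in auto)

lemma spec_eq:
  assumes "a \<in> dom (Sq Z)" "F \<in> dom (Sq Z \<rightarrow> TN)" "n \<in> dom TN"
  shows "rep (spec Z) \<bullet> a \<bullet> F \<bullet> n =
    (if \<exists>m\<in>dom TN. less m (rep Su \<bullet> n) \<and> less (F \<bullet> (rep (ext Z) \<bullet> a \<bullet> m)) m 
     then rep (zero Z) else a \<bullet> n)"
proof -
  let ?\<rho> = "id_env((''a'', Sq Z) := a, (''F'', Sq Z \<rightarrow> TN) := F)"
  define f where "f = val ?\<rho> (lam ''m'' TN (\<lambda>m. lesst \<cdot> (Fre ''F'' (Sq Z \<rightarrow> TN) \<cdot> (ext Z \<cdot> Fre ''a'' (Sq Z) \<cdot> m)) \<cdot> m))"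
  have f: "f \<in> dom (TN \<rightarrow> TB)" using assms by (simp add: f_def)
  have "f \<bullet> m = rep lesst \<bullet> (F \<bullet> (rep (ext Z) \<bullet> a \<bullet> m)) \<bullet> m" if "m \<in> dom TN" for m
    using assms that by (simp add: f_def)
  moreover have "rep (spec Z) \<bullet> a \<bullet> F \<bullet> n =
      rep (Cond Z) \<bullet> (rep bext \<bullet> f \<bullet> n) \<bullet> rep (zero Z) \<bullet> (a \<bullet> n)"
    using assms by (simp add: spec_def rep_lam f_def)
  ultimately show ?thesis
    using bool_cases[of "rep bext \<bullet> f \<bullet> n"] assms f bext_iff[OF f assms(3)] by auto
qed

text \<open>From the least stopping point on all entries are zero, so that further stopping points change
  nothing.\<close>

lemma spec_cases:
  assumes a: "a \<in> dom (Sq Z)" and F: "F \<in> dom (Sq Z \<rightarrow> TN)"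
  obtains
    "\<And>m. m \<in> dom TN \<Longrightarrow> \<not> less (F \<bullet> (rep (ext Z) \<bullet> a \<bullet> m)) m" "rep (spec Z) \<bullet> a \<bullet> F = a"
  | m where "m \<in> dom TN" "less (F \<bullet> (rep (ext Z) \<bullet> a \<bullet> m)) m"
    "\<And>j. j \<in> dom TN \<Longrightarrow> less j m \<Longrightarrow> \<not> less (F \<bullet> (rep (ext Z) \<bullet> a \<bullet> j)) j"
    "rep (spec Z) \<bullet> a \<bullet> F = rep (ext Z) \<bullet> a \<bullet> m"
proof (cases "\<exists>m\<in>dom TN. less (F \<bullet> (rep (ext Z) \<bullet> a \<bullet> m)) m")
  case False
  moreover have "rep (spec Z) \<bullet> a \<bullet> F = a"
    by (rule ap_eqI[of _ TN Z]) (use a F False in \<open>auto simp: spec_eq\<close>)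
  ultimately show ?thesis using that(1) by blast
next
  case True
  let ?Q = "\<lambda>m. less (F \<bullet> (rep (ext Z) \<bullet> a \<bullet> m)) m"
  have "\<exists>m\<in>dom TN. ?Q m \<and> (\<forall>j\<in>dom TN. less j m \<longrightarrow> \<not> ?Q j)"
    using True least_number[where Q = ?Q and x = "''m''" and
        \<rho> = "id_env((''a'', Sq Z) := a, (''F'', Sq Z \<rightarrow> TN) := F)" and
        B = "Tr (lesst \<cdot> (Fre ''F'' (Sq Z \<rightarrow> TN) \<cdot> (ext Z \<cdot> Fre ''a'' (Sq Z) \<cdot> Fre ''m'' TN)) \<cdot> Fre ''m'' TN)"]
      a F by auto
  then obtain m where m: "m \<in> dom TN" "?Q m" "\<And>j. j \<in> dom TN \<Longrightarrow> less j m \<Longrightarrow> \<not> ?Q j" by blast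
  have "rep (spec Z) \<bullet> a \<bullet> F = rep (ext Z) \<bullet> a \<bullet> m"
  proof (rule ap_eqI[of _ TN Z])
    fix n assume n: "n \<in> dom TN"
    have "(\<exists>j\<in>dom TN. less j (rep Su \<bullet> n) \<and> ?Q j) \<longleftrightarrow> less m (rep Su \<bullet> n)"
    proof
      assume "\<exists>j\<in>dom TN. less j (rep Su \<bullet> n) \<and> ?Q j"
      then obtain j where j: "j \<in> dom TN" "less j (rep Su \<bullet> n)" "?Q j" by blast
      then have "j = m \<or> less m j" using m less_linear[of j m] by blast
      then show "less m (rep Su \<bullet> n)" using j m n less_trans[of m j "rep Su \<bullet> n"] by auto
    qed (use m in blast)
    then show "rep (spec Z) \<bullet> a \<bullet> F \<bullet> n = rep (ext Z) \<bullet> a \<bullet> m \<bullet> n"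
      unfolding spec_eq[OF a F n] using a F m n not_less[of n m] by auto
  qed (use a F m in auto)
  then show ?thesis using that(2) m by blast
qed

lemma eqN_iff: "m \<in> dom TN \<Longrightarrow> n \<in> dom TN \<Longrightarrow> rep eqNt \<bullet> m \<bullet> n = rep tt \<longleftrightarrow> m = n"
  using bool_cases[of "rep lesst \<bullet> m \<bullet> n"] bool_cases[of "rep lesst \<bullet> n \<bullet> m"]
    less_linear[of m n] less_irrefl[of m]
  by (auto simp: eqNt_def rep_lam)

lemma eqB_iff: "a \<in> dom TB \<Longrightarrow> b \<in> dom TB \<Longrightarrow> rep eqBt \<bullet> a \<bullet> b = rep tt \<longleftrightarrow> a = b"
  using bool_cases[of a] bool_cases[of b] by (auto simp: eqBt_def rep_lam)

lemma chi_iff: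
  "qf A \<Longrightarrow> wff [] A \<Longrightarrow> wt_env \<rho> \<Longrightarrow> val \<rho> (chi A) = rep tt \<longleftrightarrow> sat \<rho> A"
proof (induction A)
  case (Eq Z s t)
  then show ?case by (auto simp: eqN_iff eqB_iff)
next
  case (Imp A B)
  then show ?case
    using bool_cases[of "val \<rho> (chi A)"] by auto
qed auto

end


section \<open>The recursor\<close>

lemma qf_inst [simp]: "qf (inst_fm k u A) = qf A"
  by (induction A arbitrary: k) auto

lemma fv_inst_tm: "fv_tm (inst_tm k u t) \<subseteq> fv_tm t \<union> fv_tm u"
  by (induction t arbitrary: k) auto

lemma fv_inst_fm: "fv_fm (inst_fm k u A) \<subseteq> fv_fm A \<union> fv_tm u"
proof (induction A arbitrary: k)
  case (Eq Z s t)
  then show ?case using fv_inst_tm[of k u s] fv_inst_tm[of k u t] by auto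
qed fastforce+

lemma fv_chi: "fv_tm (chi A) \<subseteq> fv_fm A"
  by (induction A) auto

lemma fv_Tr [simp]: "fv_fm (Tr b) = fv_tm b"
  by (simp add: Tr_def)

lemma qf_Tr [simp]: "qf (Tr b)"
  by (simp add: Tr_def)

lemma qf_Neg [simp]: "qf (\<^bold>\<not> A) = qf A"
  by (simp add: Neg_def)

lemma fv_Neg [simp]: "fv_fm (\<^bold>\<not> A) = fv_fm A"
  by (simp add: Neg_def)

lemma tp_tilde [simp]:
    "tp (tilde X) = Some (TyN X \<rightarrow> Sq (TProd X (Sq X \<rightarrow> TN)) \<rightarrow> TN)"
  and fv_tilde [simp]: "fv_tm (tilde X) = {}"
  by (auto simp add: tilde_def)

lemma tp_Psi [simp]: "tp (Psi X) = Some (TyN X \<rightarrow> Sq X \<rightarrow> TN)"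
  and fv_Psi [simp]: "fv_tm (Psi X) = {}"
  by (auto simp add: Psi_def)

declare zero.simps [simp del]

text \<open>The terms and formulas of the solution, before a theory is chosen: their types and variables
  determine that the formulas to be proved are well formed.\<close>

locale zl_data =
  fixes X :: ty and lt :: tm and P :: fm
  assumes rel: "prim_rec_relation X lt"
    and P: "qf_predicate X P"
begin

lemma tp_lt [simp]: "tp lt = Some (X \<rightarrow> X \<rightarrow> TB)"
  and fv_lt [simp]: "fv_tm lt = {}"
  using rel by (simp_all add: prim_rec_relation_def wt_tp)

lemma tp_eor_arg [simp]:
  "tp (eor_arg X lt Y) = Some ((Sq (TProd X (Sq X \<rightarrow> Y)) \<rightarrow> Y) \<rightarrow>
    (Sq (TProd X (Sq X \<rightarrow> Y)) \<rightarrow> TN) \<rightarrow> Sq X \<rightarrow> Sq (TProd X (Sq X \<rightarrow> Y)))"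
  and fv_eor_arg [simp]: "fv_tm (eor_arg X lt Y) = {}"
  by (auto simp add: eor_arg_def ifz_def Let_def)

lemma tp_gam [simp]: "tp (gam X lt) = Some (TyN X \<rightarrow> Sq X \<rightarrow> TyG X)"
  and fv_gam [simp]: "fv_tm (gam X lt) = {}"
  by (auto simp add: gam_def ifz_def)

lemma tp_phi [simp]: "tp (phi X lt) = Some (TyN X \<rightarrow> Sq X \<rightarrow> TN)"
  and fv_phi [simp]: "fv_tm (phi X lt) = {}"
  by (auto simp add: phi_def)

lemma tp_xi [simp]: "tp (xi X lt) = Some (TyN X \<rightarrow> TyN X \<rightarrow> TyW X \<rightarrow> Sq X \<rightarrow> Sq X)"
  and fv_xi [simp]: "fv_tm (xi X lt) = {}"
  by (auto simp add: xi_def)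

lemma wff_P: "wff [TSeq X] P"
  using P by (simp add: qf_predicate_def)

lemma wff_Pbar [simp]: "tp u = Some (Sq X) \<Longrightarrow> tp n = Some TN \<Longrightarrow> wff [] (Pbar X P u n)"
  unfolding Pbar_def by (rule wff_fill[OF wff_P]) (simp add: wt_tp)

lemma qf_Pbar [simp]: "qf (Pbar X P u n)"
  using P by (simp add: Pbar_def qf_predicate_def)

lemma wff_Cf [simp]:
  "tp v = Some (Sq X) \<Longrightarrow> tp g = Some (TyG X) \<Longrightarrow> tp m = Some TN \<Longrightarrow> tp w = Some (Sq X) \<Longrightarrow>
    wff [] (Cf X lt P v g m w)"
  by (simp add: Cf_def)

lemma wff_C0 [simp]:
  "tp N = Some (TyN X) \<Longrightarrow> tp M = Some (TyN X) \<Longrightarrow> tp W = Some (TyW X) \<Longrightarrow> tp u = Some (Sq X) \<Longrightarrow>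
    wff [] (C0 X lt P N M W u)"
  by (simp add: C0_def Let_def)

lemma qf_C0 [simp]: "qf (C0 X lt P N M W u)"
  by (simp add: C0_def Cf_def Let_def)

lemma fv_C0: "fv_fm (C0 X lt P N M W u) \<subseteq> fv_fm P \<union> fv_tm N \<union> fv_tm M \<union> fv_tm W \<union> fv_tm u"
  unfolding C0_def Cf_def Let_def Pbar_def
  by (simp, intro conjI order_trans[OF fv_inst_fm]) auto

lemma tp_useq [simp]: 
  "tp (useq X lt P) = Some (Sq X \<rightarrow> TyN X \<rightarrow> TyN X \<rightarrow> TyW X \<rightarrow> TN \<rightarrow> Sq X)"
  by (simp add: useq_def Let_def)

text \<open>As the parameters of \<open>P\<close> are named apart from the variables bound around it, the value of this
  term does not change when those variables are interpreted.\<close>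

lemma fv_useq: "fv_tm (useq X lt P) \<subseteq> fv_fm P"
proof -
  let ?v = "spec X \<cdot> Fre ''r'' (Sq X) \<cdot> (phi X lt \<cdot> Fre ''N'' (TyN X))"
  have "fv_tm (chi (C0 X lt P (Fre ''N'' (TyN X)) (Fre ''M'' (TyN X)) (Fre ''W'' (TyW X)) ?v)) \<subseteq>
    fv_fm P \<union> {(''N'', TyN X), (''M'', TyN X), (''W'', TyW X), (''r'', Sq X)}"
    by (rule order_trans[OF order_trans[OF fv_chi fv_C0]]) auto
  then show ?thesis
    unfolding useq_def Let_def fv_lam fv_tm.simps fv_spec fv_phi fv_xi by blast
qed

end

locale zl_model = henkin_theory X lt T + zl_data X lt P
  for X lt T P +
  assumes min: "zero_minimal X lt"
begin

lemma val_lt [simp]: "val \<rho> lt = rep lt"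
  by (simp add: val_closed)

abbreviation below :: "tm \<Rightarrow> tm \<Rightarrow> bool" where
  "below x y \<equiv> rep lt \<bullet> x \<bullet> y = rep tt"

lemma not_below_zero: 
  assumes "x \<in> dom X" shows "\<not> below x (rep (zero X))"
proof -
  have "sat id_env (all ''x'' X (\<lambda>x. \<^bold>\<not> Tr (lt \<cdot> x \<cdot> zero X)))"
    unfolding sat_id using min by (intro T_prov) (simp_all add: zero_minimal_def provable_def)
  then show ?thesis using assms by simp
qed

lemma zero_fun: "a \<in> dom Y \<Longrightarrow> rep (zero (Y \<rightarrow> Z)) \<bullet> a = rep (zero Z)"
  using rep_beta[of Y "zero Z" Z a] wt_zero[of "[Y]" Z] wt_zero[of "[]" Z]
  by (simp add: zero.simps wt_tp inst_tm_closed)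

lemma zero_pair: "rep (zero (TProd Y Z)) = rep (Pr Y Z) \<bullet> rep (zero Y) \<bullet> rep (zero Z)"
  by (simp add: zero.simps)

lemma eor_eq:
  assumes "Z = TProd X (Sq X \<rightarrow> Y)" "H \<in> dom (Sq Z \<rightarrow> Y)" "F \<in> dom (Sq Z \<rightarrow> TN)" "u \<in> dom (Sq X)"
  shows "rep (EOR X Y) \<bullet> H \<bullet> F \<bullet> u =
    H \<bullet> (rep (spec Z) \<bullet> (rep (eor_arg X lt Y) \<bullet> H \<bullet> F \<bullet> u) \<bullet> F)"
  using sat_axiom[OF ax_EOR_eq[of Z X Y H F u]] assms by (simp add: wt_tp val_id)

text \<open>The second component is described by its values; extensionality makes the description
  complete.\<close>

lemma eor_arg_entry:
  assumes "Z = TProd X (Sq X \<rightarrow> Y)" "H \<in> dom (Sq Z \<rightarrow> Y)" "F \<in> dom (Sq Z \<rightarrow> TN)" "u \<in> dom (Sq X)" 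
    "n \<in> dom TN"
  obtains G where "G \<in> dom (Sq X \<rightarrow> Y)" 
    "rep (eor_arg X lt Y) \<bullet> H \<bullet> F \<bullet> u \<bullet> n = rep (Pr X (Sq X \<rightarrow> Y)) \<bullet> (u \<bullet> n) \<bullet> G"
    "\<And>w. w \<in> dom (Sq X) \<Longrightarrow> G \<bullet> w = (if below (w \<bullet> rep Ze) (u \<bullet> n)
      then rep (EOR X Y) \<bullet> H \<bullet> F \<bullet> (rep (cat X) \<bullet> (rep (init X) \<bullet> u \<bullet> n) \<bullet> w) else rep (zero Y))"
proof -
  let ?Z = "TProd X (Sq X \<rightarrow> Y)"
  let ?\<rho> = "id_env((''H'', Sq ?Z \<rightarrow> Y) := H, (''F'', Sq ?Z \<rightarrow> TN) := F, (''u'', Sq X) := u, (''n'', TN) := n)"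
  let ?u = "Fre ''u'' (Sq X)" and ?n = "Fre ''n'' TN"
  let ?g = "lam ''v'' (Sq X) (\<lambda>v. ifz Y (lt \<cdot> (v \<cdot> Ze) \<cdot> (?u \<cdot> ?n))
           (EOR X Y \<cdot> Fre ''H'' (Sq ?Z \<rightarrow> Y) \<cdot> Fre ''F'' (Sq ?Z \<rightarrow> TN) \<cdot> (cat X \<cdot> (init X \<cdot> ?u \<cdot> ?n) \<cdot> v)))"
  show ?thesis
  proof
    show "val ?\<rho> ?g \<in> dom (Sq X \<rightarrow> Y)" using assms by (simp add: ifz_def)
    show "rep (eor_arg X lt Y) \<bullet> H \<bullet> F \<bullet> u \<bullet> n = rep (Pr X (Sq X \<rightarrow> Y)) \<bullet> (u \<bullet> n) \<bullet> val ?\<rho> ?g"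
      using assms by (simp add: eor_arg_def Let_def rep_lam ifz_def)
    show "val ?\<rho> ?g \<bullet> w = (if below (w \<bullet> rep Ze) (u \<bullet> n)
      then rep (EOR X Y) \<bullet> H \<bullet> F \<bullet> (rep (cat X) \<bullet> (rep (init X) \<bullet> u \<bullet> n) \<bullet> w) else rep (zero Y))"
      if "w \<in> dom (Sq X)" for w
      using assms that by (simp add: ifz_def ifz_eq)
  qed
qed

text \<open>Before \<open>m\<close> the entries agree because they depend on \<open>u\<close> only through an initial segment of
  length at most \<open>m\<close> and one entry. From \<open>m\<close> on the first component of the left-hand side is the
  zero object; as nothing lies below it, the second component vanishes and the pair is the zero
  object of the product.\<close>

lemma eor_arg_ext:
  assumes Z: "Z = TProd X (Sq X \<rightarrow> Y)" and H: "H \<in> dom (Sq Z \<rightarrow> Y)" and F: "F \<in> dom (Sq Z \<rightarrow> TN)"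
    and u: "u \<in> dom (Sq X)" and m: "m \<in> dom TN"
  shows "rep (eor_arg X lt Y) \<bullet> H \<bullet> F \<bullet> (rep (ext X) \<bullet> u \<bullet> m) =
    rep (ext Z) \<bullet> (rep (eor_arg X lt Y) \<bullet> H \<bullet> F \<bullet> u) \<bullet> m"
proof (rule ap_eqI[of _ TN Z])
  fix n assume n: "n \<in> dom TN"
  let ?u' = "rep (ext X) \<bullet> u \<bullet> m"
  have u': "?u' \<in> dom (Sq X)" using u m by simp
  obtain G where G: "G \<in> dom (Sq X \<rightarrow> Y)" 
    "rep (eor_arg X lt Y) \<bullet> H \<bullet> F \<bullet> u \<bullet> n = rep (Pr X (Sq X \<rightarrow> Y)) \<bullet> (u \<bullet> n) \<bullet> G"
    "\<And>w. w \<in> dom (Sq X) \<Longrightarrow> G \<bullet> w = (if below (w \<bullet> rep Ze) (u \<bullet> n)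
      then rep (EOR X Y) \<bullet> H \<bullet> F \<bullet> (rep (cat X) \<bullet> (rep (init X) \<bullet> u \<bullet> n) \<bullet> w) else rep (zero Y))"
    using eor_arg_entry[OF Z H F u n] by blast
  obtain G' where G': "G' \<in> dom (Sq X \<rightarrow> Y)" 
    "rep (eor_arg X lt Y) \<bullet> H \<bullet> F \<bullet> ?u' \<bullet> n = rep (Pr X (Sq X \<rightarrow> Y)) \<bullet> (?u' \<bullet> n) \<bullet> G'"
    "\<And>w. w \<in> dom (Sq X) \<Longrightarrow> G' \<bullet> w = (if below (w \<bullet> rep Ze) (?u' \<bullet> n)
      then rep (EOR X Y) \<bullet> H \<bullet> F \<bullet> (rep (cat X) \<bullet> (rep (init X) \<bullet> ?u' \<bullet> n) \<bullet> w) else rep (zero Y))"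
    using eor_arg_entry[OF Z H F u' n] by blast
  show "rep (eor_arg X lt Y) \<bullet> H \<bullet> F \<bullet> ?u' \<bullet> n =
      rep (ext Z) \<bullet> (rep (eor_arg X lt Y) \<bullet> H \<bullet> F \<bullet> u) \<bullet> m \<bullet> n"
  proof (cases "less n m")
    case True
    have "rep (init X) \<bullet> ?u' \<bullet> n = rep (init X) \<bullet> u \<bullet> n"
    proof (rule init_cong)
      fix i assume i: "i \<in> dom TN" "less i n"
      then have "less i m" using less_trans[of i n m] n m True by blast
      then show "?u' \<bullet> i = u \<bullet> i" using u m i by simp
    qed (use u' u n in auto)
    then have "G' \<bullet> w = G \<bullet> w" if "w \<in> dom (Sq X)" for w
      using G(3)[OF that] G'(3)[OF that] True u m n by simp
    then have "G' = G" by (rule ap_eqI[OF G'(1) G(1)])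
    then show ?thesis using G G' True u m n Z H F by simp
  next
    case False
    have "G' \<bullet> w = rep (zero (Sq X \<rightarrow> Y)) \<bullet> w" if "w \<in> dom (Sq X)" for w
      using G'(3)[OF that] False u m n that not_below_zero[of "w \<bullet> rep Ze"] by (simp add: zero_fun)
    moreover have "rep (zero (Sq X \<rightarrow> Y)) \<in> dom (Sq X \<rightarrow> Y)" by simp
    ultimately have "G' = rep (zero (Sq X \<rightarrow> Y))" using ap_eqI[OF G'(1)] by blast
    then show ?thesis using G' False u m n Z H F by (simp add: zero_pair)
  qed
qed (use assms in simp_all)

text \<open>By the previous lemma, \<open>F\<close> stops the argument sequence of the recursor at \<open>m\<close> if and only if \<open>f\<close>
  stops \<open>u\<close> at \<open>m\<close>. So both are left alone, or both are cut at the same least \<open>m\<close>, and cutting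
  commutes with forming the argument sequence.\<close>

theorem eor_spec:
  assumes Z: "Z = TProd X (Sq X \<rightarrow> Y)" and H: "H \<in> dom (Sq Z \<rightarrow> Y)" and F: "F \<in> dom (Sq Z \<rightarrow> TN)"
    and f: "f \<in> dom (Sq X \<rightarrow> TN)" and u: "u \<in> dom (Sq X)"
    and Ff: "\<And>u. u \<in> dom (Sq X) \<Longrightarrow> F \<bullet> (rep (eor_arg X lt Y) \<bullet> H \<bullet> F \<bullet> u) = f \<bullet> u"
  shows "rep (EOR X Y) \<bullet> H \<bullet> F \<bullet> u =
    H \<bullet> (rep (eor_arg X lt Y) \<bullet> H \<bullet> F \<bullet> (rep (spec X) \<bullet> u \<bullet> f))"
proof -
  let ?a = "rep (eor_arg X lt Y) \<bullet> H \<bullet> F \<bullet> u"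
  have a: "?a \<in> dom (Sq Z)" using assms by simp
  have ext: "F \<bullet> (rep (ext Z) \<bullet> ?a \<bullet> m) = f \<bullet> (rep (ext X) \<bullet> u \<bullet> m)" if "m \<in> dom TN" for m
    using Ff[of "rep (ext X) \<bullet> u \<bullet> m"] eor_arg_ext[OF Z H F u that] u that by simp
  have "rep (spec Z) \<bullet> ?a \<bullet> F = rep (eor_arg X lt Y) \<bullet> H \<bullet> F \<bullet> (rep (spec X) \<bullet> u \<bullet> f)"
    using u f
  proof (cases rule: spec_cases)
    case 1
    note none = this
    from a F show ?thesis
    proof (cases rule: spec_cases)
      case 1
      then show ?thesis using none by simp
    next
      case (2 m)
      then show ?thesis using none(1)[of m] ext[of m] by simp
    qed
  next
    case (2 m)
    note m = this
    from a F show ?thesis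
    proof (cases rule: spec_cases)
      case 1
      then show ?thesis using 1(1)[of m] m(1,2) ext[of m] by auto
    next
      case (2 m')
      then have "\<not> less m m'" "\<not> less m' m"
        using m(1,2) m(3)[of m'] 2(3)[of m] ext[of m] ext[of m'] by auto
      then have "m' = m" using m(1) 2(1) less_linear[of m m'] by blast
      then show ?thesis using 2(4) m(4) eor_arg_ext[OF Z H F u m(1)] by simp
    qed
  qed
  then show ?thesis using eor_eq[OF Z H F u] by simp
qed

lemma fst_eor_arg [simp]:
  assumes "wt_env \<rho>" "Z = TProd X (Sq X \<rightarrow> Y)" "H \<in> dom (Sq Z \<rightarrow> Y)" "F \<in> dom (Sq Z \<rightarrow> TN)" "u \<in> dom (Sq X)"
  shows "val (\<rho>((x, Sq Z) := rep (eor_arg X lt Y) \<bullet> H \<bullet> F \<bullet> u))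
    (lam ''n'' TN (\<lambda>n. Pfst X (Sq X \<rightarrow> Y) \<cdot> (Fre x (Sq Z) \<cdot> n))) = u" (is "?l = u")
proof (rule ap_eqI[of _ TN X])
  fix n assume n: "n \<in> dom TN"
  show "?l \<bullet> n = u \<bullet> n"
  proof -
    obtain G where "G \<in> dom (Sq X \<rightarrow> Y)"
      "rep (eor_arg X lt Y) \<bullet> H \<bullet> F \<bullet> u \<bullet> n = rep (Pr X (Sq X \<rightarrow> Y)) \<bullet> (u \<bullet> n) \<bullet> G"
      using eor_arg_entry[OF assms(2-5) n] by metis
    then show ?thesis using assms n by simp
  qed
qed (use assms in simp_all)


section \<open>The solution\<close>

lemma val_solution_terms [simp]:
  "val \<rho> (tilde X) = rep (tilde X)" "val \<rho> (Psi X) = rep (Psi X)" "val \<rho> (gam X lt) = rep (gam X lt)"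
  "val \<rho> (phi X lt) = rep (phi X lt)" "val \<rho> (xi X lt) = rep (xi X lt)"
  by (simp_all add: val_closed)

lemma gam_eq:
  assumes "N \<in> dom (TyN X)" "u \<in> dom (Sq X)" "n \<in> dom TN" "w \<in> dom (Sq X)"
  shows "rep (gam X lt) \<bullet> N \<bullet> u \<bullet> n \<bullet> w = (if below (w \<bullet> rep Ze) (u \<bullet> n)
    then rep (Psi X) \<bullet> N \<bullet> (rep (cat X) \<bullet> (rep (init X) \<bullet> u \<bullet> n) \<bullet> w) else rep (zero TN))"
  using assms by (simp add: gam_def ifz_def rep_lam ifz_eq)

lemma phi_eq:
  assumes "N \<in> dom (TyN X)" "u \<in> dom (Sq X)"
  shows "rep (phi X lt) \<bullet> N \<bullet> u = N \<bullet> u \<bullet> (rep (gam X lt) \<bullet> N \<bullet> u)"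
  using assms by (simp add: phi_def rep_lam)

lemma Psi_EOR:
  assumes "N \<in> dom (TyN X)" "u \<in> dom (Sq X)"
  shows "rep (Psi X) \<bullet> N \<bullet> u = rep (EOR X TN) \<bullet> (rep (tilde X) \<bullet> N) \<bullet> (rep (tilde X) \<bullet> N) \<bullet> u"
  using assms by (simp add: Psi_def rep_lam)

lemma xi_eq:
  assumes "N \<in> dom (TyN X)" "M \<in> dom (TyN X)" "W \<in> dom (TyW X)" "u \<in> dom (Sq X)"
  shows "rep (xi X lt) \<bullet> N \<bullet> M \<bullet> W \<bullet> u = 
    rep (cat X) \<bullet> (rep (init X) \<bullet> u \<bullet> (M \<bullet> u \<bullet> (rep (gam X lt) \<bullet> N \<bullet> u))) \<bullet>
      (W \<bullet> u \<bullet> (rep (gam X lt) \<bullet> N \<bullet> u))"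
  using assms by (simp add: xi_def rep_lam)

text \<open>The components of the argument sequence of \<open>\<Psi>\<close> at \<open>u\<close> are \<open>u\<close> and \<open>\<gamma>\<^sub>u\<close>, so the control of
  \<open>\<Psi>\<close> is \<open>\<phi>\<close> in the sense of \<open>eor_spec\<close>.\<close>

lemma tilde_eor_arg:
  assumes N: "N \<in> dom (TyN X)" and u: "u \<in> dom (Sq X)"
  shows "rep (tilde X) \<bullet> N \<bullet> 
    (rep (eor_arg X lt TN) \<bullet> (rep (tilde X) \<bullet> N) \<bullet> (rep (tilde X) \<bullet> N) \<bullet> u) = rep (phi X lt) \<bullet> N \<bullet> u"
proof -
  let ?Z = "TProd X (Sq X \<rightarrow> TN)" and ?H = "rep (tilde X) \<bullet> N"
  let ?a = "rep (eor_arg X lt TN) \<bullet> ?H \<bullet> ?H \<bullet> u"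
  let ?\<rho> = "id_env((''N'', TyN X) := N, (''a'', Sq ?Z) := ?a)"
  let ?snd = "val ?\<rho> (lam ''n'' TN (\<lambda>n. Psnd X (Sq X \<rightarrow> TN) \<cdot> (Fre ''a'' (Sq ?Z) \<cdot> n)))"
  have H: "?H \<in> dom (Sq ?Z \<rightarrow> TN)" using N by simp
  have "?snd = rep (gam X lt) \<bullet> N \<bullet> u"
  proof (rule ap_eqI[of _ TN "Sq X \<rightarrow> TN"])
    fix n assume n: "n \<in> dom TN"
    obtain G where G: "G \<in> dom (Sq X \<rightarrow> TN)" "?a \<bullet> n = rep (Pr X (Sq X \<rightarrow> TN)) \<bullet> (u \<bullet> n) \<bullet> G"
      "\<And>w. w \<in> dom (Sq X) \<Longrightarrow> G \<bullet> w = (if below (w \<bullet> rep Ze) (u \<bullet> n)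
        then rep (EOR X TN) \<bullet> ?H \<bullet> ?H \<bullet> (rep (cat X) \<bullet> (rep (init X) \<bullet> u \<bullet> n) \<bullet> w) else rep (zero TN))"
      using eor_arg_entry[OF refl H H u n] by blast
    have "G = rep (gam X lt) \<bullet> N \<bullet> u \<bullet> n"
      by (rule ap_eqI[OF G(1)]) (use N u n in \<open>auto simp: G(3) gam_eq Psi_EOR\<close>)
    then show "?snd \<bullet> n = rep (gam X lt) \<bullet> N \<bullet> u \<bullet> n"
      using G(1,2) N u n by simp
  qed (use N u in simp_all)
  moreover have "rep (tilde X) \<bullet> N \<bullet> ?a = N \<bullet> u \<bullet> ?snd"
    using N u H by (simp add: tilde_def rep_lam[of "''N''"])
  ultimately show ?thesis using N u by (simp add: phi_eq)
qed

lemma Psi_eq: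
  assumes N: "N \<in> dom (TyN X)" and u: "u \<in> dom (Sq X)"
  shows "rep (Psi X) \<bullet> N \<bullet> u = rep (phi X lt) \<bullet> N \<bullet> (rep (spec X) \<bullet> u \<bullet> (rep (phi X lt) \<bullet> N))"
  unfolding Psi_EOR[OF assms]
  by (subst eor_spec[where f = "rep (phi X lt) \<bullet> N"]) (use N u in \<open>simp_all add: tilde_eor_arg\<close>)

definition Pbar_holds :: "tm \<Rightarrow> tm \<Rightarrow> bool" where
  "Pbar_holds u n \<longleftrightarrow> P\<lbrakk>rep (init X) \<bullet> u \<bullet> n\<rbrakk> \<in> T"

definition C_holds :: "tm \<Rightarrow> tm \<Rightarrow> tm \<Rightarrow> tm \<Rightarrow> bool" where
  "C_holds v g m w \<longleftrightarrow>
    (below (w \<bullet> rep Ze) (v \<bullet> m) \<longrightarrow> \<not> Pbar_holds (rep (cat X) \<bullet> (rep (init X) \<bullet> v \<bullet> m) \<bullet> w) (g \<bullet> m \<bullet> w))"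

definition C0_holds :: "tm \<Rightarrow> tm \<Rightarrow> tm \<Rightarrow> tm \<Rightarrow> bool" where
  "C0_holds N M W u \<longleftrightarrow> (let g = rep (gam X lt) \<bullet> N \<bullet> u in C_holds u g (M \<bullet> u \<bullet> g) (W \<bullet> u \<bullet> g))"

text \<open>The parameters of \<open>P\<close> keep their meaning: they are interpreted by themselves. Binding one of the
  names in \<open>bound_names\<close> preserves this, and on such environments \<open>P\<close> denotes one fixed predicate.\<close>

definition param_env :: "(string \<times> ty \<Rightarrow> tm) \<Rightarrow> bool" where
  "param_env \<rho> \<longleftrightarrow> wt_env \<rho> \<and> (\<forall>y\<in>fv_fm P. \<rho> y = id_env y)"

lemma param_env_id [simp]: "param_env id_env"
  by (simp add: param_env_def)

lemma param_env_upd [simp]: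
  "param_env \<rho> \<Longrightarrow> x \<in> bound_names \<Longrightarrow> tp u = Some Y \<Longrightarrow> param_env (\<rho>((x, Y) := u))"
  using P by (auto simp: param_env_def qf_predicate_def)

lemma sat_Pbar [simp]:
  assumes "param_env \<rho>" "tp u = Some (Sq X)" "tp n = Some TN"
  shows "sat \<rho> (Pbar X P u n) \<longleftrightarrow> Pbar_holds (val \<rho> u) (val \<rho> n)"
proof -
  have \<rho>: "wt_env \<rho>" using assms by (simp add: param_env_def)
  let ?t = "init X \<cdot> u \<cdot> n"
  have "msub_fm \<rho> P = P" using msub_fm_cong[of P \<rho> id_env] assms by (simp add: param_env_def)
  then have "sat \<rho> (Pbar X P u n) \<longleftrightarrow> P\<lbrakk>msub_tm \<rho> ?t\<rbrakk> \<in> T"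
    using \<rho> by (simp add: sat_def Pbar_def msub_inst_fm del: msub_tm.simps)
  also have "\<dots> \<longleftrightarrow> P\<lbrakk>val \<rho> ?t\<rbrakk> \<in> T"
    unfolding val_def using wt_msub[of "[]" ?t "TSeq X" \<rho>] \<rho> assms
    by (intro fill_rep[symmetric, OF wff_P]) (simp only: wt_tp, simp)
  finally show ?thesis by (simp add: Pbar_holds_def)
qed

lemma sat_Cf [simp]:
  "param_env \<rho> \<Longrightarrow> tp v = Some (Sq X) \<Longrightarrow> tp g = Some (TyG X) \<Longrightarrow> tp m = Some TN \<Longrightarrow> tp w = Some (Sq X) \<Longrightarrow>
    sat \<rho> (Cf X lt P v g m w) \<longleftrightarrow> C_holds (val \<rho> v) (val \<rho> g) (val \<rho> m) (val \<rho> w)"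
  by (simp add: Cf_def C_holds_def param_env_def[THEN iffD1])

lemma sat_C0 [simp]:
  "param_env \<rho> \<Longrightarrow> tp N = Some (TyN X) \<Longrightarrow> tp M = Some (TyN X) \<Longrightarrow> tp W = Some (TyW X) \<Longrightarrow>
    tp u = Some (Sq X) \<Longrightarrow>
    sat \<rho> (C0 X lt P N M W u) \<longleftrightarrow> C0_holds (val \<rho> N) (val \<rho> M) (val \<rho> W) (val \<rho> u)"
  by (simp add: C0_def C0_holds_def Let_def)

lemma val_useq [simp]: "param_env \<rho> \<Longrightarrow> val \<rho> (useq X lt P) = rep (useq X lt P)"
  unfolding val_def param_env_def using fv_useq by (metis msub_id_tm msub_tm_cong subsetD)

end


context zl_model
begin

lemma Pbar_init_cong:
  "rep (init X) \<bullet> u \<bullet> n = rep (init X) \<bullet> v \<bullet> n \<Longrightarrow> Pbar_holds u n = Pbar_holds v n"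
  by (simp add: Pbar_holds_def)

text \<open>Since \<open>\<Psi> u = \<phi> v\<close>, the hypothesis is about \<open>[u](\<phi> v)\<close>. If \<open>v\<close> is \<open>u\<close> cut at \<open>m\<close>, then
  \<open>\<phi> v < m\<close> because the control stops at \<open>m\<close>, and \<open>u\<close>, \<open>v\<close> have the same initial segment of
  length \<open>\<phi> v\<close>.\<close>

lemma Pbar_spec:
  assumes N: "N \<in> dom (TyN X)" and u: "u \<in> dom (Sq X)"
    and hyp: "Pbar_holds u (rep (Psi X) \<bullet> N \<bullet> u)" and v: "v = rep (spec X) \<bullet> u \<bullet> (rep (phi X lt) \<bullet> N)"
  shows "Pbar_holds v (rep (phi X lt) \<bullet> N \<bullet> v)"
proof -
  let ?f = "rep (phi X lt) \<bullet> N"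
  have f: "?f \<in> dom (Sq X \<rightarrow> TN)" using N by simp
  have hyp: "Pbar_holds u (?f \<bullet> v)" using hyp Psi_eq[OF N u] v by simp
  from u f show ?thesis
  proof (cases rule: spec_cases)
    case 1
    then show ?thesis using hyp v by simp
  next
    case (2 m)
    have v_m: "v = rep (ext X) \<bullet> u \<bullet> m" using 2 v by simp
    have vd: "v \<in> dom (Sq X)" and fv: "?f \<bullet> v \<in> dom TN" using v_m u 2(1) N by auto
    have "less (?f \<bullet> v) m" using 2(2) v_m by simp
    then have "rep (init X) \<bullet> u \<bullet> (?f \<bullet> v) = rep (init X) \<bullet> v \<bullet> (?f \<bullet> v)"
    proof (intro init_cong[OF u vd fv])
      fix i assume i: "i \<in> dom TN" "less i (?f \<bullet> v)"
      then have "less i m" using less_trans[OF i(1) fv 2(1)] \<open>less (?f \<bullet> v) m\<close> by blast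
      then show "u \<bullet> i = v \<bullet> i" unfolding v_m using u 2(1) i(1) by simp
    qed
    then show ?thesis using hyp Pbar_init_cong by blast
  qed
qed

text \<open>The failure of \<open>C\<^sub>0\<close> consists of \<open>w\<^sub>0 \<lhd> v\<^sub>m\<close> and the truth of \<open>P\<close> on the initial segment of
  \<open>\<xi> v = [v](m) * w\<close> of length \<open>\<gamma>\<^sub>v m w\<close>; by the first part, \<open>\<gamma>\<^sub>v m w = \<Psi> (\<xi> v)\<close>.\<close>

lemma Pbar_xi:
  assumes N: "N \<in> dom (TyN X)" and M: "M \<in> dom (TyN X)" and W: "W \<in> dom (TyW X)"
    and v: "v \<in> dom (Sq X)" and C: "\<not> C0_holds N M W v"
  shows "Pbar_holds (rep (xi X lt) \<bullet> N \<bullet> M \<bullet> W \<bullet> v) (rep (Psi X) \<bullet> N \<bullet> (rep (xi X lt) \<bullet> N \<bullet> M \<bullet> W \<bullet> v))"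
  using C assms by (simp add: C0_holds_def C_holds_def Let_def gam_eq xi_eq)

text \<open>A second instance of the recursor, again controlled by \<open>\<phi>\<close>, which counts the steps that remain.
  Its \<open>H\<close> returns zero where \<open>C\<^sub>0\<close> holds. Where \<open>C\<^sub>0\<close> fails at \<open>v\<close>, it adds one to a recursive call
  at \<open>\<xi> v = [v](m) * w\<close>; the recursor permits this call since the failure includes \<open>w\<^sub>0 \<lhd> v\<^sub>m\<close>.\<close>

lemma step_counter:
  assumes N: "N \<in> dom (TyN X)" and M: "M \<in> dom (TyN X)" and W: "W \<in> dom (TyW X)"
  obtains E where "E \<in> dom (Sq X \<rightarrow> TN)"
    "\<And>u v. u \<in> dom (Sq X) \<Longrightarrow> v = rep (spec X) \<bullet> u \<bullet> (rep (phi X lt) \<bullet> N) \<Longrightarrow> \<not> C0_holds N M W v \<Longrightarrow>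
      E \<bullet> u = rep Su \<bullet> (E \<bullet> (rep (xi X lt) \<bullet> N \<bullet> M \<bullet> W \<bullet> v))"
proof -
  define Z where "Z = TProd X (Sq X \<rightarrow> TN)"
  let ?N = "Fre ''N'' (TyN X)" and ?M = "Fre ''M'' (TyN X)" and ?W = "Fre ''W'' (TyW X)"
  let ?\<rho> = "id_env((''N'', TyN X) := N, (''M'', TyN X) := M, (''W'', TyW X) := W)"
  let ?u = "\<lambda>a. lam ''n'' TN (\<lambda>n. Pfst X (Sq X \<rightarrow> TN) \<cdot> (a \<cdot> n))"
  let ?g = "\<lambda>a. gam X lt \<cdot> ?N \<cdot> ?u a"
  define F where "F = val ?\<rho> (lam ''r'' (Sq Z) (\<lambda>a. phi X lt \<cdot> ?N \<cdot> ?u a))"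
  define H where "H = val ?\<rho> (lam ''r'' (Sq Z) (\<lambda>a.
    Cond TN \<cdot> chi (C0 X lt P ?N ?M ?W (?u a)) \<cdot> Ze \<cdot>
      (Su \<cdot> (Psnd X (Sq X \<rightarrow> TN) \<cdot> (a \<cdot> (?M \<cdot> ?u a \<cdot> ?g a)) \<cdot> (?W \<cdot> ?u a \<cdot> ?g a)))))"
  have F: "F \<in> dom (Sq Z \<rightarrow> TN)" and H: "H \<in> dom (Sq Z \<rightarrow> TN)"
    using N M W by (simp_all add: F_def H_def Z_def)
  let ?E = "rep (EOR X TN) \<bullet> H \<bullet> F" and ?a = "\<lambda>u. rep (eor_arg X lt TN) \<bullet> H \<bullet> F \<bullet> u"
  let ?r = "Fre ''r'' (Sq Z)" and ?rho = "\<lambda>a. ?\<rho>((''r'', Sq Z) := a)"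
  let ?fst = "\<lambda>a. val (?rho a) (?u ?r)"
  let ?chi = "\<lambda>a. val (?rho a) (chi (C0 X lt P ?N ?M ?W (?u ?r)))"
  have F_ap: "F \<bullet> a = rep (phi X lt) \<bullet> N \<bullet> ?fst a" if "a \<in> dom (Sq Z)" for a
    using that N M W by (simp add: F_def Z_def del: val_upd_lam)
  have H_ap: "H \<bullet> a = (let u = ?fst a; g = rep (gam X lt) \<bullet> N \<bullet> u in
      rep (Cond TN) \<bullet> ?chi a \<bullet> rep Ze \<bullet>
        (rep Su \<bullet> (rep (Psnd X (Sq X \<rightarrow> TN)) \<bullet> (a \<bullet> (M \<bullet> u \<bullet> g)) \<bullet> (W \<bullet> u \<bullet> g))))"
    if "a \<in> dom (Sq Z)" for a
    using that N M W by (simp add: H_def Z_def Let_def del: val_upd_lam)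
  have a: "?a u \<in> dom (Sq Z)" and fst: "?fst (?a u) = u" if "u \<in> dom (Sq X)" for u
    using that F H N M W fst_eor_arg[OF _ Z_def H F that, of ?\<rho> "''r''"] by (simp_all add: Z_def)
  \<comment> \<open>The hypothesis of \<open>eor_spec\<close>: on argument sequences, this control is \<open>\<phi>\<close>.\<close>
  have Fa: "F \<bullet> ?a u = rep (phi X lt) \<bullet> N \<bullet> u" if "u \<in> dom (Sq X)" for u
    unfolding F_ap[OF a[OF that]] fst[OF that] ..
  have Ha: "H \<bullet> ?a v = rep Su \<bullet> (?E \<bullet> (rep (xi X lt) \<bullet> N \<bullet> M \<bullet> W \<bullet> v))"
    if v: "v \<in> dom (Sq X)" and C: "\<not> C0_holds N M W v" for v
  proof -
    let ?G = "rep (gam X lt) \<bullet> N \<bullet> v"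
    let ?m = "M \<bullet> v \<bullet> ?G" and ?w = "W \<bullet> v \<bullet> ?G"
    have m: "?m \<in> dom TN" using M N v by simp
    have env: "param_env (?rho (?a v))" "wt_env (?rho (?a v))"
      using N M W a[OF v] by (simp_all add: bound_names_def)
    have u: "tp (?u ?r) = Some (Sq X)" by (simp add: Z_def)
    have "?chi (?a v) = rep ff"
    proof -
      have "\<not> sat (?rho (?a v)) (C0 X lt P ?N ?M ?W (?u ?r))"
        using C env u fst[OF v] N M W by simp
      then show ?thesis
        using chi_iff[of "C0 X lt P ?N ?M ?W (?u ?r)" "?rho (?a v)"] env u bool_cases[of "?chi (?a v)"]
        by simp
    qed
    then have "H \<bullet> ?a v = rep (Cond TN) \<bullet> rep ff \<bullet> rep Ze \<bullet>
        (rep Su \<bullet> (rep (Psnd X (Sq X \<rightarrow> TN)) \<bullet> (?a v \<bullet> ?m) \<bullet> ?w))"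
      by (simp only: H_ap[OF a[OF v]] fst[OF v] Let_def)
    also have "rep (Psnd X (Sq X \<rightarrow> TN)) \<bullet> (?a v \<bullet> ?m) \<bullet> ?w = ?E \<bullet> (rep (xi X lt) \<bullet> N \<bullet> M \<bullet> W \<bullet> v)"
    proof -
      obtain G where G: "G \<in> dom (Sq X \<rightarrow> TN)" "?a v \<bullet> ?m = rep (Pr X (Sq X \<rightarrow> TN)) \<bullet> (v \<bullet> ?m) \<bullet> G"
        "\<And>w. w \<in> dom (Sq X) \<Longrightarrow> G \<bullet> w = (if below (w \<bullet> rep Ze) (v \<bullet> ?m)
          then ?E \<bullet> (rep (cat X) \<bullet> (rep (init X) \<bullet> v \<bullet> ?m) \<bullet> w) else rep (zero TN))"
        using eor_arg_entry[OF Z_def H F v m] by blast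
      have "below (?w \<bullet> rep Ze) (v \<bullet> ?m)" using C by (simp add: C0_holds_def C_holds_def Let_def)
      then show ?thesis using G(1,2) G(3)[of ?w] N M W v by (simp add: xi_eq)
    qed
    finally show ?thesis using N M W v H F by (simp add: Z_def)
  qed
  show ?thesis
  proof
    show "?E \<in> dom (Sq X \<rightarrow> TN)" using F H by (simp add: Z_def)
    fix u v assume u: "u \<in> dom (Sq X)" and v: "v = rep (spec X) \<bullet> u \<bullet> (rep (phi X lt) \<bullet> N)"
      and C: "\<not> C0_holds N M W v"
    have f: "rep (phi X lt) \<bullet> N \<in> dom (Sq X \<rightarrow> TN)" using N by simp
    then have "v \<in> dom (Sq X)" using u v by simp
    then show "?E \<bullet> u = rep Su \<bullet> (?E \<bullet> (rep (xi X lt) \<bullet> N \<bullet> M \<bullet> W \<bullet> v))"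
      using eor_spec[OF Z_def H F f u Fa] Ha C v by simp
  qed
qed

context
  fixes ub N M W :: tm
  assumes ub: "ub \<in> dom (Sq X)" and N: "N \<in> dom (TyN X)" and M: "M \<in> dom (TyN X)" and W: "W \<in> dom (TyW X)"
begin

text \<open>In the notation of the theory, \<open>U i\<close> is \<open>u\<^sub>i\<close> and \<open>V i\<close> is \<open>spec u\<^sub>i \<phi>\<close>.\<close>

abbreviation U :: "tm \<Rightarrow> tm" where
  "U i \<equiv> rep (useq X lt P) \<bullet> ub \<bullet> N \<bullet> M \<bullet> W \<bullet> i"

abbreviation V :: "tm \<Rightarrow> tm" where
  "V i \<equiv> rep (spec X) \<bullet> U i \<bullet> (rep (phi X lt) \<bullet> N)"

lemma U_dom: "i \<in> dom TN \<Longrightarrow> U i \<in> dom (Sq X)"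
  and V_dom: "i \<in> dom TN \<Longrightarrow> V i \<in> dom (Sq X)"
  using ub N M W by simp_all

text \<open>The case distinction in the definition of \<open>u\<^sub>i\<close> is made by a characteristic term, which decides
  \<open>C\<^sub>0\<close> in the model because \<open>C\<^sub>0\<close> is quantifier-free.\<close>

lemma U_eqs:
  "U (rep Ze) = ub"
  "i \<in> dom TN \<Longrightarrow> U (rep Su \<bullet> i) = (if C0_holds N M W (V i) then V i else rep (xi X lt) \<bullet> N \<bullet> M \<bullet> W \<bullet> V i)"
proof -
  let ?N = "Fre ''N'' (TyN X)" and ?M = "Fre ''M'' (TyN X)" and ?W = "Fre ''W'' (TyW X)"
  let ?v = "\<lambda>r. spec X \<cdot> r \<cdot> (phi X lt \<cdot> ?N)"
  let ?\<rho> = "id_env((''ub'', Sq X) := ub, (''N'', TyN X) := N, (''M'', TyN X) := M, (''W'', TyW X) := W)"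
  define step where "step = val ?\<rho> (lam ''i'' TN (\<lambda>i. lam ''r'' (Sq X) (\<lambda>r.
     Cond (Sq X) \<cdot> chi (C0 X lt P ?N ?M ?W (?v r)) \<cdot> ?v r \<cdot> (xi X lt \<cdot> ?N \<cdot> ?M \<cdot> ?W \<cdot> ?v r))))"
  have step: "step \<in> dom (TN \<rightarrow> Sq X \<rightarrow> Sq X)" using ub N M W by (simp add: step_def)
  have U: "rep (useq X lt P) \<bullet> ub \<bullet> N \<bullet> M \<bullet> W = rep (Rec (Sq X)) \<bullet> ub \<bullet> step"
    using ub N M W by (simp add: useq_def Let_def rep_lam[of "''ub''"] step_def)
  show "U (rep Ze) = ub" using ub step by (simp add: U)
  assume i: "i \<in> dom TN"
  let ?\<rho>' = "?\<rho>((''i'', TN) := i, (''r'', Sq X) := U i)"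
  let ?r = "Fre ''r'' (Sq X)"
  have env: "param_env ?\<rho>'" "wt_env ?\<rho>'" 
    using ub N M W i U_dom[OF i] by (simp_all add: bound_names_def)
  have "U (rep Su \<bullet> i) = step \<bullet> i \<bullet> U i"
    using ub step i by (simp add: U)
  also have "\<dots> = rep (Cond (Sq X)) \<bullet> val ?\<rho>' (chi (C0 X lt P ?N ?M ?W (?v ?r))) \<bullet> V i \<bullet>
      (rep (xi X lt) \<bullet> N \<bullet> M \<bullet> W \<bullet> V i)"
    using ub N M W i U_dom[OF i] by (simp add: step_def)
  finally have eq: "U (rep Su \<bullet> i) = rep (Cond (Sq X)) \<bullet> val ?\<rho>' (chi (C0 X lt P ?N ?M ?W (?v ?r))) \<bullet> V i \<bullet>
      (rep (xi X lt) \<bullet> N \<bullet> M \<bullet> W \<bullet> V i)" .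
  have "val ?\<rho>' (chi (C0 X lt P ?N ?M ?W (?v ?r))) = rep tt \<longleftrightarrow> C0_holds N M W (V i)"
    using chi_iff[of "C0 X lt P ?N ?M ?W (?v ?r)" ?\<rho>'] env ub N M W U_dom[OF i] by simp
  then show "U (rep Su \<bullet> i) = (if C0_holds N M W (V i) then V i else rep (xi X lt) \<bullet> N \<bullet> M \<bullet> W \<bullet> V i)"
    using eq bool_cases[of "val ?\<rho>' (chi (C0 X lt P ?N ?M ?W (?v ?r)))"] env N M W V_dom[OF i]
    by auto
qed

text \<open>Otherwise the step counter, evaluated along the sequence, would descend forever.\<close>

lemma C0_reached: "\<exists>k\<in>dom TN. C0_holds N M W (V k)"
proof (rule ccontr)
  assume never: "\<not> ?thesis"
  obtain E where E: "E \<in> dom (Sq X \<rightarrow> TN)" and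
    E_step: "\<And>u v. u \<in> dom (Sq X) \<Longrightarrow> v = rep (spec X) \<bullet> u \<bullet> (rep (phi X lt) \<bullet> N) \<Longrightarrow> \<not> C0_holds N M W v \<Longrightarrow>
      E \<bullet> u = rep Su \<bullet> (E \<bullet> (rep (xi X lt) \<bullet> N \<bullet> M \<bullet> W \<bullet> v))"
    using step_counter[OF N M W] by blast
  let ?\<rho> = "id_env((''ub'', Sq X) := ub, (''N'', TyN X) := N, (''M'', TyN X) := M, (''W'', TyW X) := W,
    (''g'', Sq X \<rightarrow> TN) := E)"
  define h where "h = val ?\<rho> (lam ''j'' TN (\<lambda>j. Fre ''g'' (Sq X \<rightarrow> TN) \<cdot> (useq X lt P \<cdot> Fre ''ub'' (Sq X) \<cdot>
    Fre ''N'' (TyN X) \<cdot> Fre ''M'' (TyN X) \<cdot> Fre ''W'' (TyW X) \<cdot> j)))"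
  have h: "h \<bullet> j = E \<bullet> U j" if "j \<in> dom TN" for j
    using that ub N M W E by (simp add: h_def bound_names_def)
  show False
  proof (rule no_infinite_descent)
    show "h \<in> dom (TN \<rightarrow> TN)" using ub N M W E by (simp add: h_def)
    fix j assume j: "j \<in> dom TN"
    then have "E \<bullet> U j = rep Su \<bullet> (E \<bullet> U (rep Su \<bullet> j))"
      using E_step[OF U_dom[OF j] refl] never by (simp add: U_eqs(2)[OF j])
    then show "h \<bullet> j = rep Su \<bullet> (h \<bullet> (rep Su \<bullet> j))"
      using h[OF j] h[of "rep Su \<bullet> j"] j by simp
  qed
qed

lemma least_k: "\<exists>k\<in>dom TN. C0_holds N M W (V k) \<and> (\<forall>j\<in>dom TN. less j k \<longrightarrow> \<not> C0_holds N M W (V j))"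
proof -
  let ?\<rho> = "id_env((''ub'', Sq X) := ub, (''N'', TyN X) := N, (''M'', TyN X) := M, (''W'', TyW X) := W)"
  let ?B = "C0 X lt P (Fre ''N'' (TyN X)) (Fre ''M'' (TyN X)) (Fre ''W'' (TyW X))
    (vk X lt P (Fre ''ub'' (Sq X)) (Fre ''N'' (TyN X)) (Fre ''M'' (TyN X)) (Fre ''W'' (TyW X)) (Fre ''k'' TN))"
  obtain k where k: "k \<in> dom TN" "C0_holds N M W (V k)" using C0_reached by blast
  show ?thesis
    by (rule least_number[where \<rho> = ?\<rho> and B = ?B and x = "''k''" and Q = "\<lambda>k. C0_holds N M W (V k)", OF _ _ _ k])
      (use ub N M W in \<open>simp_all add: vk_def bound_names_def\<close>)
qed

text \<open>The invariant of the sequence before \<open>C\<^sub>0\<close> is reached. The formula of the induction contains \<open>P\<close>,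
  hence its variables are taken from \<open>bound_names\<close>.\<close>

lemma Pbar_U:
  assumes start: "Pbar_holds ub (rep (Psi X) \<bullet> N \<bullet> ub)" and i: "i \<in> dom TN"
    and before: "\<And>j. j \<in> dom TN \<Longrightarrow> less j i \<Longrightarrow> \<not> C0_holds N M W (V j)"
  shows "Pbar_holds (U i) (rep (Psi X) \<bullet> N \<bullet> U i)"
proof -
  let ?ub = "Fre ''ub'' (Sq X)" and ?i = "Fre ''i'' TN"
  let ?N = "Fre ''N'' (TyN X)" and ?M = "Fre ''M'' (TyN X)" and ?W = "Fre ''W'' (TyW X)"
  let ?\<rho> = "id_env((''ub'', Sq X) := ub, (''N'', TyN X) := N, (''M'', TyN X) := M, (''W'', TyW X) := W)"
  let ?u = "useq X lt P \<cdot> ?ub \<cdot> ?N \<cdot> ?M \<cdot> ?W \<cdot> ?i"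
  let ?Q = "\<lambda>i. (\<forall>j\<in>dom TN. less j i \<longrightarrow> \<not> C0_holds N M W (V j)) \<longrightarrow> Pbar_holds (U i) (rep (Psi X) \<bullet> N \<bullet> U i)"
  have "?Q i"
  proof (rule nat_induction[where \<rho> = ?\<rho> and x = "''i''" and Q = ?Q and
        B = "all ''j'' TN (\<lambda>j. Tr (lesst \<cdot> j \<cdot> ?i) \<^bold>\<longrightarrow> \<^bold>\<not> C0 X lt P ?N ?M ?W (vk X lt P ?ub ?N ?M ?W j)) \<^bold>\<longrightarrow>
          Pbar X P ?u (Psi X \<cdot> ?N \<cdot> ?u)", OF _ _ _ _ _ i])
    show "?Q (rep Ze)" using start by (simp add: U_eqs)
  next
    fix i assume i: "i \<in> dom TN" and IH: "?Q i"
    show "?Q (rep Su \<bullet> i)"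
    proof
      assume *: "\<forall>j\<in>dom TN. less j (rep Su \<bullet> i) \<longrightarrow> \<not> C0_holds N M W (V j)"
      then have "\<not> C0_holds N M W (V i)" using i less_suc[OF i i] by blast
      then show "Pbar_holds (U (rep Su \<bullet> i)) (rep (Psi X) \<bullet> N \<bullet> U (rep Su \<bullet> i))"
        using Pbar_xi[OF N M W V_dom[OF i]] U_eqs(2)[OF i] by simp
    qed
  qed (use ub N M W in \<open>simp_all add: vk_def bound_names_def\<close>)
  then show ?thesis using before by blast
qed

lemma solution:
  assumes "Pbar_holds ub (rep (Psi X) \<bullet> N \<bullet> ub)" "k \<in> dom TN"
    and "\<And>j. j \<in> dom TN \<Longrightarrow> less j k \<Longrightarrow> \<not> C0_holds N M W (V j)"
  shows "Pbar_holds (V k) (N \<bullet> V k \<bullet> (rep (gam X lt) \<bullet> N \<bullet> V k))"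
  using Pbar_spec[OF N U_dom[OF assms(2)] Pbar_U[OF assms] refl] phi_eq[OF N V_dom[OF assms(2)]] by simp

end

lemma ZL_matrix_solution:
  assumes ub: "ub \<in> dom (Sq X)" and N: "N \<in> dom (TyN X)" and M: "M \<in> dom (TyN X)" and W: "W \<in> dom (TyW X)"
    and k: "k \<in> dom TN" "C0_holds N M W (V ub N M W k)"
      "\<forall>j\<in>dom TN. less j k \<longrightarrow> \<not> C0_holds N M W (V ub N M W j)"
    and start: "Pbar_holds ub (rep (Psi X) \<bullet> N \<bullet> ub)"
  defines "v \<equiv> V ub N M W k"
  defines "g \<equiv> rep (gam X lt) \<bullet> N \<bullet> v"
  shows "Pbar_holds v (N \<bullet> v \<bullet> g) \<and> C_holds v g (M \<bullet> v \<bullet> g) (W \<bullet> v \<bullet> g)"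
  using solution[OF ub N M W start k(1)] k by (simp add: v_def g_def C0_holds_def Let_def)

lemma explicit_solution:
  "sat id_env (all ''ub'' (Sq X) (\<lambda>ub. all ''N'' (TyN X) (\<lambda>N. all ''M'' (TyN X) (\<lambda>M. all ''W'' (TyW X) (\<lambda>W.
        ex ''k'' TN (\<lambda>k. is_least_k X lt P ub N M W k) \<^bold>\<and>
        all ''k'' TN (\<lambda>k. is_least_k X lt P ub N M W k \<^bold>\<longrightarrow>
          (let n = Psi X \<cdot> N \<cdot> ub;
               v = vk X lt P ub N M W k;
               g = gam X lt \<cdot> N \<cdot> v
           in ZL_matrix X lt P ub N M W n v g)))))))"
  using least_k ZL_matrix_solution
  by (simp add: is_least_k_def ZL_matrix_def vk_def bound_names_def Let_def)

lemma functional_interpretation: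
  "sat id_env (all ''ub'' (Sq X) (\<lambda>ub. all ''N'' (TyN X) (\<lambda>N. all ''M'' (TyN X) (\<lambda>M. all ''W'' (TyW X) (\<lambda>W.
        ex ''n'' TN (\<lambda>n. ex ''v'' (Sq X) (\<lambda>v. ex ''g'' (TyG X) (\<lambda>g.
          ZL_matrix X lt P ub N M W n v g))))))))"
proof -
  have "\<exists>n\<in>dom TN. \<exists>v\<in>dom (Sq X). \<exists>g\<in>dom (TyG X).
      Pbar_holds ub n \<longrightarrow> Pbar_holds v (N \<bullet> v \<bullet> g) \<and> C_holds v g (M \<bullet> v \<bullet> g) (W \<bullet> v \<bullet> g)"
    if dom: "ub \<in> dom (Sq X)" "N \<in> dom (TyN X)" "M \<in> dom (TyN X)" "W \<in> dom (TyW X)" for ub N M W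
  proof -
    obtain k where k: "k \<in> dom TN" "C0_holds N M W (V ub N M W k)"
        "\<forall>j\<in>dom TN. less j k \<longrightarrow> \<not> C0_holds N M W (V ub N M W j)"
      using least_k[OF dom] by blast
    have "V ub N M W k \<in> dom (Sq X)" by (rule V_dom[OF dom k(1)])
    moreover from this have "rep (gam X lt) \<bullet> N \<bullet> V ub N M W k \<in> dom (TyG X)"
      "rep (Psi X) \<bullet> N \<bullet> ub \<in> dom TN" using dom by auto
    ultimately show ?thesis using ZL_matrix_solution[OF dom k] by blast
  qed
  then show ?thesis by (simp add: ZL_matrix_def bound_names_def)
qed

end

theorem theorem8p3:
  fixes X :: ty and lt :: tm and P :: fm
  assumes rel: "prim_rec_relation X lt"
    and wf: "wellfounded_relation X lt"
    and min: "zero_minimal X lt"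
    and P: "qf_predicate X P"
  shows
    "provable X lt
      (all ''ub'' (Sq X) (\<lambda>ub. all ''N'' (TyN X) (\<lambda>N. all ''M'' (TyN X) (\<lambda>M. all ''W'' (TyW X) (\<lambda>W.
        ex ''k'' TN (\<lambda>k. is_least_k X lt P ub N M W k) \<^bold>\<and>
        all ''k'' TN (\<lambda>k. is_least_k X lt P ub N M W k \<^bold>\<longrightarrow>
          (let n = Psi X \<cdot> N \<cdot> ub;
               v = vk X lt P ub N M W k;
               g = gam X lt \<cdot> N \<cdot> v
           in ZL_matrix X lt P ub N M W n v g)))))))
     \<and>
     provable X lt
      (all ''ub'' (Sq X) (\<lambda>ub. all ''N'' (TyN X) (\<lambda>N. all ''M'' (TyN X) (\<lambda>M. all ''W'' (TyW X) (\<lambda>W.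
        ex ''n'' TN (\<lambda>n. ex ''v'' (Sq X) (\<lambda>v. ex ''g'' (TyG X) (\<lambda>g.
          ZL_matrix X lt P ub N M W n v g))))))))"
    (is "provable X lt ?A \<and> provable X lt ?B")
proof -
  interpret zl_data X lt P by unfold_locales (fact rel P)+
  have "wff [] ?A" "wff [] ?B"
    by (simp_all add: is_least_k_def ZL_matrix_def vk_def Let_def)
  moreover have "?A \<in> T" "?B \<in> T" if "henkin (axs X lt) T" for T
  proof -
    interpret zl_model X lt T P using that min by unfold_locales
    show "?A \<in> T" "?B \<in> T"
      using explicit_solution functional_interpretation unfolding sat_id by blast+
  qed
  ultimately show ?thesis by (auto simp only: provable_def intro!: completeness)
qed

end
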